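(* Let $\Omega\subseteq\mathbb{C}$ be a proper simply connected domain with an antiholomorphic involution $\sigma$, and let $f^\sharp(z) := \overline{f(\sigma(z))}$ for $f\in H^\infty(\Omega)$. The weakly continuous $*$-homomorphisms $(H^\infty(\Omega),\sharp)\to\mathbb{C}$ are the maps $$\delta_\lambda(f) := f(\lambda)\quad\text{for}\quad\lambda\in\Omega^\sigma = \{z\in\Omega:\sigma(z) = z\}.$$
   Context: $H^\infty(\Omega)$ is the Banach algebra of bounded holomorphic functions on $\Omega$ with the sup norm. The antiholomorphic involution is of the form $\sigma(z) = \varphi(\overline{\varphi^{-1}(z)})$ for a biholomorphic map $\varphi:\mathbb{D}\to\Omega$ from the open unit disc. With the isometric antilinear involution $\sharp$, $H^\infty(\Omega)$ is a Banach $*$-algebra; a $*$-homomorphism $\chi:(H^\infty(\Omega),\sharp)\to\mathbb{C}$ is an algebra homomorphism with $\chi(f^\sharp) = \overline{\chi(f)}$. By Ando's Theorem, $H^\infty(\Omega)$ has a unique predual $H^\infty(\Omega)_*\subseteq H^\infty(\Omega)^*$; the weak topology on $H^\infty(\Omega)$ is the initial topology defined by the functionals in $H^\infty(\Omega)_*$ (i.e. the weak-$*$ topology). Concretely, for a biholomorphic map $\varphi:\mathbb{D}\to\Omega$, it is the initial topology with respect to the functionals $f\mapsto\int_0^{2\pi}F(e^{it})(f\circ\varphi)^*(e^{it})\,dt$, $F\in L^1(\mathbb{T})$, where $\mathbb{T}$ is the unit circle and $(\cdot)^*$ denotes non-tangential boundary values. *)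

theory Defs
  imports "HOL-Complex_Analysis.Complex_Analysis"
begin

definition biholomorphic_map :: "complex set \<Rightarrow> complex set \<Rightarrow> (complex \<Rightarrow> complex) \<Rightarrow> bool" where
  "biholomorphic_map S T \<phi> \<longleftrightarrow>
     \<phi> holomorphic_on S \<and> bij_betw \<phi> S T \<and> inv_into S \<phi> holomorphic_on T"

definition antiholomorphic_involution :: "complex set \<Rightarrow> (complex \<Rightarrow> complex) \<Rightarrow> bool" where
  "antiholomorphic_involution \<Omega> \<sigma> \<longleftrightarrow>
     \<sigma> ` \<Omega> \<subseteq> \<Omega> \<and> (\<lambda>z. cnj (\<sigma> z)) holomorphic_on \<Omega> \<and> (\<forall>z\<in>\<Omega>. \<sigma> (\<sigma> z) = z)"

(* A function on \<Omega> is represented by its extension by 0 to all of \<complex>, so that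
   equality in Hinf \<Omega> is equality of functions on \<Omega>, and the pointwise operations
   stay inside the carrier. The unit is the indicator function of \<Omega>. *)
definition Hinf :: "complex set \<Rightarrow> (complex \<Rightarrow> complex) set" where
  "Hinf \<Omega> = {f. f holomorphic_on \<Omega> \<and> bounded (f ` \<Omega>) \<and> (\<forall>z. z \<notin> \<Omega> \<longrightarrow> f z = 0)}"

definition Hinf_one :: "complex set \<Rightarrow> complex \<Rightarrow> complex" where
  "Hinf_one \<Omega> = (\<lambda>z. if z \<in> \<Omega> then 1 else 0)"

definition sharp :: "complex set \<Rightarrow> (complex \<Rightarrow> complex) \<Rightarrow> (complex \<Rightarrow> complex) \<Rightarrow> complex \<Rightarrow> complex" where
  "sharp \<Omega> \<sigma> f = (\<lambda>z. if z \<in> \<Omega> then cnj (f (\<sigma> z)) else 0)"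

(* Homomorphisms of unital algebras, so that the zero functional is excluded. *)
definition algebra_hom :: "complex set \<Rightarrow> ((complex \<Rightarrow> complex) \<Rightarrow> complex) \<Rightarrow> bool" where
  "algebra_hom \<Omega> \<psi> \<longleftrightarrow>
     (\<forall>f\<in>Hinf \<Omega>. \<forall>g\<in>Hinf \<Omega>. \<psi> (\<lambda>z. f z + g z) = \<psi> f + \<psi> g) \<and>
     (\<forall>c. \<forall>f\<in>Hinf \<Omega>. \<psi> (\<lambda>z. c * f z) = c * \<psi> f) \<and>
     (\<forall>f\<in>Hinf \<Omega>. \<forall>g\<in>Hinf \<Omega>. \<psi> (\<lambda>z. f z * g z) = \<psi> f * \<psi> g) \<and>
     \<psi> (Hinf_one \<Omega>) = 1"

definition star_hom ::
    "complex set \<Rightarrow> (complex \<Rightarrow> complex) \<Rightarrow> ((complex \<Rightarrow> complex) \<Rightarrow> complex) \<Rightarrow> bool" where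
  "star_hom \<Omega> \<sigma> \<psi> \<longleftrightarrow>
     algebra_hom \<Omega> \<psi> \<and> (\<forall>f\<in>Hinf \<Omega>. \<psi> (sharp \<Omega> \<sigma> f) = cnj (\<psi> f))"

(* Nontangential approach (Stolz) region in the unit disc at \<zeta> of aperture \<alpha>. *)
definition approach_region :: "real \<Rightarrow> complex \<Rightarrow> complex set" where
  "approach_region \<alpha> \<zeta> = {z \<in> ball 0 1. dist z \<zeta> < \<alpha> * (1 - norm z)}"

(* Non-tangential boundary value. By Fatou's theorem the limit exists for almost every \<zeta>
   on the unit circle if g is bounded and holomorphic on the disc; the value at the
   remaining points is irrelevant below. *)
definition boundary_value :: "(complex \<Rightarrow> complex) \<Rightarrow> complex \<Rightarrow> complex" where
  "boundary_value g \<zeta> = (THE l. \<forall>\<alpha>>1. (g \<longlongrightarrow> l) (at \<zeta> within approach_region \<alpha> \<zeta>))"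

(* L^1 of the unit circle: only the values on the circle matter, and functions that agree
   almost everywhere define the same functional below. Lebesgue (rather than Borel)
   measurability makes null sets harmless. *)
definition L1_circle :: "(complex \<Rightarrow> complex) set" where
  "L1_circle = {F. set_integrable lebesgue {0..2*pi} (\<lambda>t. F (cis t))}"

definition predual_functional ::
    "(complex \<Rightarrow> complex) \<Rightarrow> (complex \<Rightarrow> complex) \<Rightarrow> (complex \<Rightarrow> complex) \<Rightarrow> complex" where
  "predual_functional \<phi> F f =
     (LINT t:{0..2*pi}|lebesgue. F (cis t) * boundary_value (f \<circ> \<phi>) (cis t))"

(* The predual of Hinf \<Omega>, unique by Ando's theorem, realised through a biholomorphic map \<phi>
   from the unit disc onto \<Omega>. As a set of functionals on Hinf \<Omega> it does not depend on \<phi>. *)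
definition Hinf_predual :: "(complex \<Rightarrow> complex) \<Rightarrow> ((complex \<Rightarrow> complex) \<Rightarrow> complex) set" where
  "Hinf_predual \<phi> = predual_functional \<phi> ` L1_circle"

(* Initial topology on Hinf \<Omega> with respect to the functionals in the predual. *)
definition weak_topology ::
    "complex set \<Rightarrow> (complex \<Rightarrow> complex) \<Rightarrow> (complex \<Rightarrow> complex) topology" where
  "weak_topology \<Omega> \<phi> =
     topology_generated_by {{f \<in> Hinf \<Omega>. \<Lambda> f \<in> U} | \<Lambda> U. \<Lambda> \<in> Hinf_predual \<phi> \<and> open U}"

lemma topspace_weak_topology: "topspace (weak_topology \<Omega> \<phi>) = Hinf \<Omega>"
proof -
  have "(\<lambda>_. 0) \<in> L1_circle"
    by (simp add: L1_circle_def set_integrable_def)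
  then have "predual_functional \<phi> (\<lambda>_. 0) \<in> Hinf_predual \<phi>"
    by (simp add: Hinf_predual_def)
  then have "\<exists>\<Lambda> U. Hinf \<Omega> = {f \<in> Hinf \<Omega>. \<Lambda> f \<in> U} \<and> \<Lambda> \<in> Hinf_predual \<phi> \<and> open U"
    by (intro exI[of _ "predual_functional \<phi> (\<lambda>_. 0)"] exI[of _ UNIV]) simp
  then show ?thesis
    unfolding weak_topology_def topology_generated_by_topspace by blast
qed

definition point_eval :: "complex set \<Rightarrow> complex \<Rightarrow> (complex \<Rightarrow> complex) \<Rightarrow> complex" where
  "point_eval \<Omega> w = (\<lambda>f\<in>Hinf \<Omega>. f w)"

end

theory Submission
  imports Defs
begin

text \<open>
  Transport everything to the unit disc by \<open>\<phi>\<close>. By Fatou's theorem and dominated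
  convergence, evaluation at \<open>u\<close> is integration of the boundary values against the Cauchy
  kernel \<open>\<zeta> / (2 \<pi> (\<zeta> - u))\<close>, hence weakly continuous. Conversely, let \<open>\<psi>\<close> be a weakly
  continuous character and \<open>w\<close> its value at the coordinate function of the disc. If \<open>|w| \<ge> 1\<close>,
  the functions \<open>((1 + z/w)/2)^n\<close> tend to 0 weakly, although \<open>\<psi>\<close> maps each of them to 1; so
  \<open>|w| < 1\<close>, and applying \<open>\<psi>\<close> to \<open>f - f(w) = (z - w) h\<close> gives \<open>\<psi> f = f(w)\<close>. Compatibility with
  the involution at the coordinate function forces the point to be fixed by \<open>\<sigma>\<close>.

  Fatou's theorem is obtained from a primitive \<open>G\<close> of the bounded function: it is Lipschitz
  up to the boundary, so \<open>t \<mapsto> G(cis t)\<close> is differentiable almost everywhere, and at such points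
  a Lindelof-type argument turns tangential differentiability of \<open>G\<close> into a non-tangential
  limit of \<open>G'\<close>.
\<close>

section \<open>Differentiability of Lipschitz functions almost everywhere\<close>

text \<open>One-sided Lebesgue differentiation: the cubes with lowest corner \<open>x\<close> in the
  multivariate statement are, on the line, the intervals to the right of \<open>x\<close>.\<close>

lemma locally_integrable_right_average_tendsto:
  fixes f :: "real \<Rightarrow> real"
  assumes int: "\<And>a b. f integrable_on {a..b}"
  shows "\<exists>N. negligible N \<and> (\<forall>x. x \<notin> N \<longrightarrow> ((\<lambda>h. integral {x..x + h} f / h) \<longlongrightarrow> f x) (at_right 0))"
proof -
  have "f integrable_on cbox a b" for a b using int by simp
  then obtain N where N: "negligible N"
    "\<And>x e. \<lbrakk>x \<notin> N; 0 < e\<rbrakk> \<Longrightarrow> \<exists>d>0. \<forall>h. 0 < h \<and> h < d \<longrightarrow>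
        norm (integral (cbox x (x + h *\<^sub>R One)) f /\<^sub>R h ^ DIM(real) - f x) < e"
    by (rule integrable_ccontinuous_explicit) (rule that)
  have "((\<lambda>h. integral {x..x + h} f / h) \<longlongrightarrow> f x) (at_right 0)" if xN: "x \<notin> N" for x
  proof (rule tendstoI)
    fix e :: real assume "0 < e"
    then obtain d where d: "d > 0" "\<forall>h. 0 < h \<and> h < d \<longrightarrow>
        norm (integral (cbox x (x + h *\<^sub>R One)) f /\<^sub>R h ^ DIM(real) - f x) < e"
      using N(2)[OF xN] by blast
    show "\<forall>\<^sub>F h in at_right 0. dist (integral {x..x + h} f / h) (f x) < e"
      unfolding eventually_at_right_field
    proof (intro exI[of _ d] conjI allI impI)
      fix h assume "0 < h" "h < d"
      with d(2)[rule_format, of h] show "dist (integral {x..x + h} f / h) (f x) < e"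
        by (simp add: divide_inverse mult.commute dist_real_def)
    qed (use d in auto)
  qed
  with N(1) show ?thesis by blast
qed

text \<open>Right difference quotients of \<open>F\<close> are right averages of \<open>f\<close>;
  left ones are right averages of the reflected function \<open>\<lambda>x. f (- x)\<close> at
  \<open>- x\<close>. The exceptional set is that of \<open>f\<close> together with the mirror image
  of that of its reflection.\<close>

lemma has_real_derivative_integral_AE:
  fixes F f :: "real \<Rightarrow> real"
  assumes I: "\<And>a b. a \<le> b \<Longrightarrow> (f has_integral (F b - F a)) {a..b}"
  shows "negligible {x. \<not> (F has_real_derivative f x) (at x)}"
proof -
  have int: "f integrable_on {a..b}" for a b
    using I[of a b] by (cases "a \<le> b") (auto simp: integrable_on_def)
  have int': "(\<lambda>x. f (- x)) integrable_on {a..b}" for a b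
    using int[of "-b" "-a"] Henstock_Kurzweil_Integration.integrable_reflect_real[where a="-b" and b="-a" and f=f]
    by simp
  have ig: "integral {a..b} f = F b - F a" if "a \<le> b" for a b
    using I[OF that] by (rule integral_unique)
  obtain N1 where N1: "negligible N1"
    "\<forall>x. x \<notin> N1 \<longrightarrow> ((\<lambda>h. integral {x..x + h} f / h) \<longlongrightarrow> f x) (at_right 0)"
    using locally_integrable_right_average_tendsto[of f, OF int] by (elim exE conjE) (rule that)
  obtain N2 where N2: "negligible N2"
    "\<forall>x. x \<notin> N2 \<longrightarrow> ((\<lambda>h. integral {x..x + h} (\<lambda>x. f (- x)) / h) \<longlongrightarrow> f (- x)) (at_right 0)"
    using locally_integrable_right_average_tendsto[of "\<lambda>x. f (- x)", OF int'] by (elim exE conjE) (rule that)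
  have "negligible (uminus ` N2)"
    by (intro negligible_differentiable_image_negligible[OF order_refl N2(1)] derivative_intros)
  then have neg: "negligible (N1 \<union> uminus ` N2)" using N1(1) by (rule negligible_Un[rotated])
  have "(F has_real_derivative f x) (at x)" if x: "x \<notin> N1 \<union> uminus ` N2" for x
    unfolding DERIV_def
  proof (rule filterlim_split_at)
    have "((\<lambda>h. integral {x..x + h} f / h) \<longlongrightarrow> f x) (at_right 0)" using N1(2) x by simp
    then show "((\<lambda>h. (F (x + h) - F x) / h) \<longlongrightarrow> f x) (at_right 0)"
      by (rule Lim_transform_eventually) (auto intro!: eventually_at_rightI[of 0 1] simp: ig)
    have "- x \<notin> N2" using x by (auto simp: image_iff)
    then have "((\<lambda>h. integral {-x..-x + h} (\<lambda>x. f (- x)) / h) \<longlongrightarrow> f x) (at_right 0)"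
      using N2(2)[rule_format, of "-x"] by simp
    moreover have "integral {-x..-x + h} (\<lambda>x. f (- x)) / h = (F (x + - h) - F x) / - h" if "0 < h" for h
      using Henstock_Kurzweil_Integration.integral_reflect_real[where a="x - h" and b=x and f=f] ig[of "x - h" x] that
      by (simp add: minus_divide_left)
    ultimately have "((\<lambda>h. (F (x + - h) - F x) / - h) \<longlongrightarrow> f x) (at_right 0)"
      by (elim Lim_transform_eventually) (auto intro!: eventually_at_rightI[of 0 1])
    then show "((\<lambda>h. (F (x + h) - F x) / h) \<longlongrightarrow> f x) (at_left 0)"
      unfolding filterlim_at_left_to_right by simp
  qed
  then have "{x. \<not> (F has_real_derivative f x) (at x)} \<subseteq> N1 \<union> uminus ` N2" by blast
  with neg show ?thesis by (rule negligible_subset)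
qed

text \<open>
  Adding a large linear term makes \<open>f\<close> a bi-Lipschitz bijection \<open>F\<close>; the measure
  \<open>A \<mapsto> |F(A)|\<close> is then absolutely continuous, and \<open>F\<close> is the indefinite integral of its density.
\<close>
lemma lipschitz_differentiable_AE:
  fixes f :: "real \<Rightarrow> real"
  assumes "L-lipschitz_on UNIV f"
  shows "negligible {x. \<not> f differentiable (at x)}"
proof -
  have L: "L \<ge> 0" "\<And>x y. \<bar>f x - f y\<bar> \<le> L * \<bar>x - y\<bar>"
    using assms by (auto simp: lipschitz_on_def dist_real_def)
  \<comment> \<open>All slopes of \<open>f\<close> lie between \<open>- L\<close> and
    \<open>L\<close>, so adding slope \<open>L + 1\<close> puts those of \<open>F\<close> between 1
    and \<open>2 * L + 1\<close>.\<close>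
  define F where "F = (\<lambda>x. f x + (L + 1) * x)"
  have F_exp: "y - x \<le> F y - F x" if "x \<le> y" for x y
    using L(2)[of y x] that by (simp add: F_def algebra_simps)
  have F_lip: "\<bar>F y - F x\<bar> \<le> (2 * L + 1) * \<bar>y - x\<bar>" for x y
  proof -
    have "\<bar>F y - F x\<bar> = \<bar>(f y - f x) + (L + 1) * (y - x)\<bar>" by (simp add: F_def algebra_simps)
    also have "\<dots> \<le> \<bar>f y - f x\<bar> + \<bar>(L + 1) * (y - x)\<bar>" by (rule abs_triangle_ineq)
    also have "\<dots> \<le> L * \<bar>y - x\<bar> + (L + 1) * \<bar>y - x\<bar>"
      using L(2)[of y x] L(1) by (simp add: abs_mult)
    finally show ?thesis by (simp add: algebra_simps)
  qed
  have F_mono: "F x < F y \<longleftrightarrow> x < y" for x y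
    using F_exp[of x y] F_exp[of y x] by linarith
  have F_mono': "F x \<le> F y \<longleftrightarrow> x \<le> y" for x y
    using F_mono[of y x] by linarith
  have contf: "continuous_on UNIV f" using assms lipschitz_on_continuous_on by blast
  have contF: "continuous_on UNIV F"
    unfolding F_def by (intro continuous_intros contf)
  have "inj F" by (rule injI) (simp only: order.eq_iff F_mono')
  \<comment> \<open>Since \<open>F\<close> grows at least as fast as the identity, moving from 0 by
    \<bar>y - F 0\<bar> in both directions brackets \<open>y\<close>.\<close>
  have ex: "\<exists>x. F x = y" for y
  proof -
    define b where "b = \<bar>y - F 0\<bar>"
    have "F (-b) \<le> y" "y \<le> F b" using F_exp[of "-b" 0] F_exp[of 0 b] by (auto simp: b_def)
    then show ?thesis
      using IVT'[of F "-b" y b] continuous_on_subset[OF contF] by (auto simp: b_def)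
  qed
  have "bij F" using \<open>inj F\<close> surjI[of F "\<lambda>y. SOME x. F x = y", OF someI_ex[OF ex]] by (rule bijI)
  define \<psi> where "\<psi> = inv F"
  have \<psi>F: "\<psi> (F x) = x" and F\<psi>: "F (\<psi> x) = x" for x
    using \<open>bij F\<close> by (auto simp: \<psi>_def bij_is_inj bij_is_surj surj_f_inv_f)
  have "mono \<psi>" by (rule monoI) (simp only: F_mono'[symmetric, of "\<psi> _"] F\<psi>)
  then have [measurable]: "\<psi> \<in> borel_measurable borel" by (rule borel_measurable_mono)
  have vim: "\<psi> -` A = F ` A" for A :: "real set" using bij_vimage_eq_inv_image[OF bij_imp_bij_inv[OF \<open>bij F\<close>]]
    by (simp add: \<psi>_def inv_inv_eq[OF \<open>bij F\<close>])
  define \<nu> where "\<nu> = distr lborel borel \<psi>"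
  have em: "emeasure \<nu> A = emeasure lborel (F ` A)" if "A \<in> sets borel" for A
    using that unfolding \<nu>_def by (subst emeasure_distr) (auto simp: vim)
  have ac: "absolutely_continuous lborel \<nu>"
    unfolding absolutely_continuous_def
  proof
    fix A :: "real set" assume A: "A \<in> null_sets lborel"
    then have neg: "negligible A" by (simp add: negligible_iff_null_sets null_sets_completionI)
    have "negligible (F ` A)"
      by (rule negligible_locally_Lipschitz_image[OF _ neg])
         (auto intro!: exI[of _ UNIV] exI[of _ "2*L+1"] F_lip)
    moreover have "F ` A \<in> sets borel"
      using A measurable_sets[of \<psi> borel borel A] by (auto simp: vim[symmetric])
    ultimately have "F ` A \<in> null_sets lborel"
      by (simp add: negligible_iff_null_sets null_sets_completion_iff)
    then show "A \<in> null_sets \<nu>"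
      using A em[of A] by (auto simp: null_sets_def \<nu>_def)
  qed
  obtain g where g[measurable]: "g \<in> borel_measurable lborel" and gd: "density lborel g = \<nu>"
    using sigma_finite_measure.Radon_Nikodym[OF sigma_finite_lborel ac] by (auto simp: \<nu>_def)
  have nn: "(\<integral>\<^sup>+x. g x * indicator {a..b} x \<partial>lborel) = ennreal (F b - F a)" if "a \<le> b" for a b
  proof -
    have "F ` {a..b} = {F a..F b}"
    proof -
      have "y \<in> F ` {a..b}" if "F a \<le> y" "y \<le> F b" for y
        using that F\<psi>[of y] F_mono'[of a "\<psi> y"] F_mono'[of "\<psi> y" b] by (intro image_eqI[of _ _ "\<psi> y"]) auto
      then show ?thesis using F_mono' by auto
    qed
    then show ?thesis
      using em[of "{a..b}"] that F_mono'[of a b] unfolding gd[symmetric] by (simp add: emeasure_density)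
  qed
  \<comment> \<open>The density takes values in [0, infinity]. Its finite integrals over the
    intervals [-n, n] make it finite almost everywhere, so \<open>enn2real\<close> changes it only
    on a null set.\<close>
  have fin: "AE x in lborel. g x \<noteq> \<infinity>"
  proof -
    have "AE x in lborel. g x * indicator {- real n..real n} x \<noteq> \<infinity>" for n
      by (rule nn_integral_noteq_infinite) (auto simp: nn)
    then have "AE x in lborel. \<forall>n. g x * indicator {- real n..real n} x \<noteq> \<infinity>"
      by (simp add: AE_all_countable)
    then show ?thesis
    proof eventually_elim
      case (elim x)
      obtain n where "\<bar>x\<bar> \<le> real n" using real_arch_simple by blast
      then show ?case using elim[rule_format, of n] by (simp add: abs_le_iff minus_le_iff)
    qed
  qed
  have "((\<lambda>x. enn2real (g x)) has_integral (F b - F a)) {a..b}" if "a \<le> b" for a b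
  proof -
    have "((\<lambda>x. enn2real (g x) * indicator {a..b} x) has_integral (F b - F a)) UNIV"
    proof (rule nn_integral_has_integral)
      have "(\<integral>\<^sup>+x. ennreal (enn2real (g x) * indicator {a..b} x) \<partial>lborel)
          = (\<integral>\<^sup>+x. g x * indicator {a..b} x \<partial>lborel)"
        by (rule nn_integral_cong_AE, use fin in eventually_elim)
           (auto simp: indicator_def ennreal_enn2real_if)
      then show "(\<integral>\<^sup>+x. ennreal (enn2real (g x) * indicator {a..b} x) \<partial>lborel) = ennreal (F b - F a)"
        using nn[OF that] by simp
    qed (use that F_mono'[of a b] in \<open>auto simp: indicator_def\<close>)
    moreover have "(\<lambda>x. enn2real (g x) * indicator {a..b} x) = (\<lambda>x. if x \<in> {a..b} then enn2real (g x) else 0)"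
      by (auto simp: fun_eq_iff)
    ultimately show ?thesis
      by (simp only: has_integral_restrict_UNIV)
  qed
  then have "negligible {x. \<not> (F has_real_derivative enn2real (g x)) (at x)}"
    by (rule has_real_derivative_integral_AE)
  moreover have "f differentiable (at x)" if "(F has_real_derivative enn2real (g x)) (at x)" for x
  proof -
    have "(\<lambda>x. F x - (L + 1) * x) differentiable (at x)"
      using that by (intro derivative_intros) (auto simp: real_differentiable_def)
    then show ?thesis by (simp add: F_def)
  qed
  ultimately show ?thesis
    by (elim negligible_subset) auto
qed

section \<open>Fatou's theorem for bounded holomorphic functions\<close>

text \<open>
  The maximum principle is applied to \<open>(k/(z - \<zeta>) \<cdot> p^N)^m (z - \<zeta>)\<close>. Here \<open>p\<close> peaks at \<open>\<zeta>\<close>, so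
  that \<open>p^N\<close> suppresses the part of the circle away from \<open>\<zeta>\<close>; the last factor removes the possible
  discontinuity at \<open>\<zeta>\<close>, and its effect disappears as \<open>m \<rightarrow> \<infinity>\<close>.
\<close>
lemma holomorphic_little_o_at_boundary_point:
  fixes k :: "complex \<Rightarrow> complex"
  assumes contk: "continuous_on (cball 0 1) k" and holk: "k holomorphic_on ball 0 1"
    and \<zeta>: "norm \<zeta> = 1"
    and C: "\<And>z. z \<in> cball 0 1 \<Longrightarrow> norm (k z) \<le> C * dist z \<zeta>"
    and small: "\<And>e. e > 0 \<Longrightarrow> \<exists>\<eta>>0. \<forall>z. norm z = 1 \<and> dist z \<zeta> < \<eta> \<longrightarrow> norm (k z) \<le> e * dist z \<zeta>"
    and e: "e > 0"
  shows "\<exists>\<eta>>0. \<forall>z\<in>ball 0 1. dist z \<zeta> < \<eta> \<longrightarrow> norm (k z) \<le> e * dist z \<zeta>"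
proof -
  define p where "p = (\<lambda>z. (1 + cnj \<zeta> * z) / 2)"
  have \<zeta>cnj: "\<zeta> * cnj \<zeta> = 1" "cnj \<zeta> * \<zeta> = 1"
    using \<zeta> complex_norm_square[of \<zeta>] by (auto simp: mult.commute)
  have p_le1: "norm (p z) \<le> 1" if "z \<in> cball 0 1" for z
  proof -
    have "norm (1 + cnj \<zeta> * z) \<le> 1 + norm (cnj \<zeta> * z)" by (metis norm_one norm_triangle_ineq)
    also have "\<dots> \<le> 2" using that \<zeta> by (simp add: norm_mult)
    finally show ?thesis by (simp add: p_def norm_divide)
  qed
  \<comment> \<open>In the rotated variable \<open>u\<close> the function \<open>p\<close> is (1 +
    u)/2, and on the circle the parallelogram law gives |1 + u|^2 + |u - 1|^2 = 4.\<close>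
  have p_circle: "(norm (p z))\<^sup>2 = 1 - (dist z \<zeta>)\<^sup>2 / 4" if "norm z = 1" for z
  proof -
    define u where "u = cnj \<zeta> * z"
    have nu: "norm u = 1" using that \<zeta> by (simp add: u_def norm_mult)
    have "z - \<zeta> = \<zeta> * (u - 1)" using \<zeta>cnj by (simp add: u_def algebra_simps)
    then have "dist z \<zeta> = norm (u - 1)" using \<zeta> by (simp add: dist_norm norm_mult)
    moreover have "(norm (1 + u))\<^sup>2 + (norm (u - 1))\<^sup>2 = 4"
    proof -
      have "(Re u)\<^sup>2 + (Im u)\<^sup>2 = 1" using nu cmod_power2[of u] by simp
      then show ?thesis unfolding cmod_power2 by (simp add: power2_eq_square algebra_simps)
    qed
    moreover have "(norm (p z))\<^sup>2 = (norm (1 + u))\<^sup>2 / 4"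
      by (simp add: p_def u_def norm_divide power_divide)
    ultimately show ?thesis by simp
  qed
  \<comment> \<open>The antipode of \<open>\<zeta>\<close> lies at distance 2, so the bound on
    \<open>k\<close> there forces the sign of \<open>C\<close>.\<close>
  have C0: "C \<ge> 0"
  proof -
    have "- \<zeta> - \<zeta> = - 2 * \<zeta>" by simp
    then have "dist (- \<zeta>) \<zeta> = 2" using \<zeta> by (simp only: dist_norm norm_mult) simp
    then have "0 \<le> C * 2" using order_trans[OF norm_ge_zero C[of "- \<zeta>"]] \<zeta> by simp
    then show ?thesis by simp
  qed
  obtain \<eta> where \<eta>: "\<eta> > 0" "\<And>z. norm z = 1 \<Longrightarrow> dist z \<zeta> < \<eta> \<Longrightarrow> norm (k z) \<le> e / 2 * dist z \<zeta>"
    using small[of "e/2"] e by auto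
  \<comment> \<open>A bound for |p| on the part of the circle at distance at least
    \<open>\<eta>\<close> from \<open>\<zeta>\<close>. The \<open>max 0\<close> covers \<eta> > 2,
    where no such points exist.\<close>
  define \<rho> where "\<rho> = sqrt (max 0 (1 - \<eta>\<^sup>2 / 4))"
  have \<rho>: "0 \<le> \<rho>" "\<rho> < 1" using \<eta>(1) by (auto simp: \<rho>_def)
  have p_\<rho>: "norm (p z) \<le> \<rho>" if "norm z = 1" "dist z \<zeta> \<ge> \<eta>" for z
  proof -
    have "\<eta>\<^sup>2 \<le> (dist z \<zeta>)\<^sup>2" using that \<eta>(1) by (intro power_mono) auto
    then have "(norm (p z))\<^sup>2 \<le> max 0 (1 - \<eta>\<^sup>2 / 4)" using p_circle[OF that(1)] by simp
    then show ?thesis unfolding \<rho>_def by (rule real_le_rsqrt)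
  qed
  \<comment> \<open>Away from \<open>\<zeta>\<close> the quotient of \<open>k\<close> by z - \<zeta>
    is only known to be bounded by \<open>C\<close>; \<open>N\<close> is large enough for the power
    of \<open>p\<close> to bring it below \<open>e / 2\<close>.\<close>
  obtain N where N: "C * \<rho> ^ N \<le> e / 2"
  proof -
    have "(\<lambda>n. C * \<rho> ^ n) \<longlonglongrightarrow> C * 0"
      using \<rho> by (intro tendsto_intros LIMSEQ_realpow_zero)
    then have "eventually (\<lambda>n. C * \<rho> ^ n < e / 2) sequentially"
      using e by (intro order_tendstoD) auto
    then show ?thesis using that by (auto simp: eventually_sequentially intro: less_imp_le)
  qed
  \<comment> \<open>Division by zero gives \<open>q \<zeta> = 0\<close>, so the bounds below hold at
    \<open>\<zeta>\<close> too.\<close>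
  define q where "q = (\<lambda>z. k z / (z - \<zeta>) * p z ^ N)"
  have q_le: "norm (q z) \<le> C" if "z \<in> cball 0 1" for z
  proof (cases "z = \<zeta>")
    case False
    have "norm (q z) \<le> norm (k z / (z - \<zeta>))"
      unfolding q_def norm_mult norm_power
      using p_le1[OF that] by (intro mult_right_le_one_le) (auto simp: power_le_one)
    also have "\<dots> \<le> C" using C[OF that] False by (simp add: norm_divide dist_norm divide_le_eq)
    finally show ?thesis .
  qed (use C0 in \<open>simp add: q_def\<close>)
  have q_circle: "norm (q z) \<le> e / 2" if "norm z = 1" for z
  proof (cases "z = \<zeta>")
    case False
    then have d: "dist z \<zeta> > 0" by simp
    have nq: "norm (q z) = norm (k z) / dist z \<zeta> * norm (p z) ^ N"
      by (simp add: q_def norm_mult norm_divide norm_power dist_norm)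
    show ?thesis
    proof (cases "dist z \<zeta> < \<eta>")
      case True
      have "norm (k z) / dist z \<zeta> * norm (p z) ^ N \<le> norm (k z) / dist z \<zeta>"
        using p_le1[of z] that by (intro mult_right_le_one_le) (auto simp: power_le_one)
      also have "\<dots> \<le> e / 2" using \<eta>(2)[OF that True] d by (simp add: divide_le_eq)
      finally show ?thesis using nq by simp
    next
      case False
      have "norm (k z) / dist z \<zeta> * norm (p z) ^ N \<le> C * \<rho> ^ N"
        using C[of z] that d p_\<rho>[of z] False C0
        by (intro mult_mono power_mono) (auto simp: divide_le_eq)
      then show ?thesis using nq N by linarith
    qed
  qed (use e in \<open>simp add: q_def\<close>)
  have q_ball: "norm (q z) \<le> e / 2" if z: "z \<in> ball 0 1" for z
  proof (rule ccontr)
    assume "\<not> ?thesis"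
    then have gt: "1 < norm (q z) / (e / 2)" using e by simp
    have "z \<noteq> \<zeta>" using z \<zeta> by auto
    \<comment> \<open>If |q z| exceeded \<open>e / 2\<close>, some power of the ratio would outgrow
      2 / |z - \<zeta>|. Here 2 bounds the factor z - \<zeta> on the circle, so the maximum
      principle for \<open>\<Phi>\<close> is contradicted.\<close>
    obtain m where m: "2 / dist z \<zeta> < (norm (q z) / (e / 2)) ^ m"
      using real_arch_pow[OF gt] by blast
    define \<Phi> where "\<Phi> = (\<lambda>z. q z ^ m * (z - \<zeta>))"
    have "norm (\<Phi> z) \<le> 2 * (e / 2) ^ m"
    proof (rule maximum_modulus_frontier[of \<Phi> "ball 0 1"])
      show "\<Phi> holomorphic_on interior (ball 0 1)"
        unfolding \<Phi>_def q_def p_def using \<zeta> by (auto intro!: holomorphic_intros holk)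
      show "continuous_on (closure (ball 0 1)) \<Phi>"
        unfolding continuous_on_eq_continuous_within
      proof
        fix x :: complex assume "x \<in> closure (ball 0 1)"
        then have x: "x \<in> cball 0 1" by simp
        have "continuous (at x within cball 0 1) \<Phi>"
        proof (cases "x = \<zeta>")
          case False
          have "continuous (at x within cball 0 1) k"
            using contk x continuous_on_eq_continuous_within by blast
          then show ?thesis
            unfolding \<Phi>_def q_def p_def using False by (auto intro!: continuous_intros)
        next
          case True
          have "(\<Phi> \<longlongrightarrow> 0) (at \<zeta> within cball 0 1)"
          proof (rule Lim_null_comparison)
            show "\<forall>\<^sub>F y in at \<zeta> within cball 0 1. norm (\<Phi> y) \<le> C ^ m * norm (y - \<zeta>)"
              unfolding eventually_at_filter \<Phi>_def norm_mult norm_power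
              by (intro always_eventually allI impI mult_right_mono power_mono q_le) auto
            have "((\<lambda>y. C ^ m * norm (y - \<zeta>)) \<longlongrightarrow> C ^ m * norm (\<zeta> - \<zeta>)) (at \<zeta> within cball 0 1)"
              by (intro tendsto_intros)
            then show "((\<lambda>y. C ^ m * norm (y - \<zeta>)) \<longlongrightarrow> 0) (at \<zeta> within cball 0 1)" by simp
          qed
          then show ?thesis using True by (simp add: continuous_within \<Phi>_def)
        qed
        then show "continuous (at x within closure (ball 0 1)) \<Phi>" by simp
      qed
      show "norm (\<Phi> x) \<le> 2 * (e / 2) ^ m" if "x \<in> frontier (ball 0 1)" for x
      proof -
        have x: "norm x = 1" using that by simp
        have "norm (x - \<zeta>) \<le> 2" using norm_triangle_ineq4[of x \<zeta>] x \<zeta> by simp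
        then have "norm (q x) ^ m * norm (x - \<zeta>) \<le> (e / 2) ^ m * 2"
          using q_circle[OF x] e by (intro mult_mono power_mono) auto
        then show ?thesis by (simp add: \<Phi>_def norm_mult norm_power)
      qed
    qed (use z in auto)
    then have "norm (q z) ^ m * dist z \<zeta> \<le> 2 * (e / 2) ^ m"
      unfolding \<Phi>_def norm_mult norm_power dist_norm .
    moreover have "(e / 2) ^ m > 0" "dist z \<zeta> > 0" using e \<open>z \<noteq> \<zeta>\<close> by auto
    ultimately have "(norm (q z) / (e / 2)) ^ m \<le> 2 / dist z \<zeta>"
      unfolding power_divide[of "norm (q z)"] by (simp only: pos_divide_le_eq pos_le_divide_eq times_divide_eq_left)
    with m show False by simp
  qed
  \<comment> \<open>Near \<open>\<zeta>\<close> the power of \<open>p\<close> has modulus above 1/2,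
    so removing it from \<open>q\<close> costs a factor 2. This is why \<open>q\<close> was bounded
    by \<open>e / 2\<close>.\<close>
  have "((\<lambda>z. norm (p z) ^ N) \<longlongrightarrow> norm (p \<zeta>) ^ N) (at \<zeta>)"
    unfolding p_def by (intro tendsto_intros) auto
  moreover have "p \<zeta> = 1" by (simp add: p_def \<zeta>cnj)
  ultimately have "eventually (\<lambda>z. norm (p z) ^ N > 1/2) (at \<zeta>)"
    by (intro order_tendstoD) auto
  then obtain d where d: "d > 0" "\<And>z. z \<noteq> \<zeta> \<Longrightarrow> dist z \<zeta> < d \<Longrightarrow> norm (p z) ^ N > 1/2"
    unfolding eventually_at by auto
  show ?thesis
  proof (intro exI[of _ d] conjI ballI impI)
    fix z :: complex assume z: "z \<in> ball 0 1" "dist z \<zeta> < d"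
    have "z \<noteq> \<zeta>" using z \<zeta> by auto
    then have dz: "dist z \<zeta> > 0" by simp
    have "norm (k z) / dist z \<zeta> * (1/2) \<le> norm (k z) / dist z \<zeta> * norm (p z) ^ N"
      using d(2)[OF \<open>z \<noteq> \<zeta>\<close> z(2)] by (intro mult_left_mono) auto
    also have "\<dots> \<le> e / 2"
      using q_ball[OF z(1)] by (simp add: q_def norm_mult norm_divide norm_power dist_norm)
    finally show "norm (k z) \<le> e * dist z \<zeta>" using dz by (simp add: field_simps)
  qed (use d in auto)
qed

text \<open>Subtracting the affine function with slope \<open>l\<close> leaves \<open>k\<close>,
  which is o(|z - \<zeta>|) along the circle and hence, by the previous lemma, throughout the disc.
  In an approach region the distance to \<open>\<zeta>\<close> is comparable to the distance to the
  circle, so Cauchy's estimate makes the derivative \<open>g z - l\<close> of \<open>k\<close> tend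
  to 0.\<close>

lemma nontangential_limit_of_derivative:
  fixes G g :: "complex \<Rightarrow> complex"
  assumes lip: "M-lipschitz_on (cball 0 1) G"
    and deriv: "\<And>z. z \<in> ball 0 1 \<Longrightarrow> (G has_field_derivative g z) (at z)"
    and D: "((\<lambda>t. G (cis t)) has_vector_derivative D) (at t)"
  shows "\<exists>l. \<forall>\<alpha>>1. (g \<longlongrightarrow> l) (at (cis t) within approach_region \<alpha> (cis t))"
proof -
  define \<zeta> where "\<zeta> = cis t"
  have \<zeta>: "norm \<zeta> = 1" by (simp add: \<zeta>_def)
  \<comment> \<open>The chain rule along t \<mapsto> cis t suggests D = G'(\<zeta>) i \<zeta>; this
    solves for the derivative.\<close>
  define l where "l = D / (\<i> * \<zeta>)"
  have Dl: "D = l * (\<i> * \<zeta>)" using \<zeta> by (auto simp: l_def)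
  define k where "k = (\<lambda>z. G z - G \<zeta> - l * (z - \<zeta>))"
  have contk: "continuous_on (cball 0 1) k"
    unfolding k_def using lip by (intro continuous_intros lipschitz_on_continuous_on)
  have derivk: "(k has_field_derivative (g z - l)) (at z)" if "z \<in> ball 0 1" for z
    unfolding k_def using deriv[OF that] by (auto intro!: derivative_eq_intros)
  then have holk: "k holomorphic_on ball 0 1"
    using holomorphic_on_open by blast
  have kC: "norm (k z) \<le> (M + norm l) * dist z \<zeta>" if "z \<in> cball 0 1" for z
  proof -
    have "norm (k z) \<le> norm (G z - G \<zeta>) + norm (l * (z - \<zeta>))"
      unfolding k_def by (rule norm_triangle_ineq4)
    also have "norm (G z - G \<zeta>) \<le> M * dist z \<zeta>"
      using lipschitz_onD[OF lip that, of \<zeta>] \<zeta> by (simp add: dist_norm)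
    finally show ?thesis by (simp add: norm_mult dist_norm distrib_right)
  qed
  have small: "\<exists>\<eta>>0. \<forall>z. norm z = 1 \<and> dist z \<zeta> < \<eta> \<longrightarrow> norm (k z) \<le> e * dist z \<zeta>" if "e > 0" for e
  proof -
    have cis_deriv: "(cis has_vector_derivative \<i> * cis t) (at t)"
      unfolding has_vector_derivative_def
      by (rule has_derivative_eq_rhs[OF has_derivative_cis[OF has_derivative_ident]])
         (simp add: fun_eq_iff scaleR_conv_of_real mult_ac)
    have "((\<lambda>s. k (cis s)) has_vector_derivative (D - l * (\<i> * cis t))) (at t)"
      unfolding k_def
      by (auto intro!: derivative_eq_intros D cis_deriv)
    then have "((\<lambda>s. k (cis s)) has_vector_derivative 0) (at t)"
      by (simp add: Dl \<zeta>_def)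
    then have "\<forall>e'>0. \<exists>d>0. \<forall>s. norm (s - t) < d \<longrightarrow> norm (k (cis s) - k (cis t) - (s - t) *\<^sub>R 0) \<le> e' * norm (s - t)"
      unfolding has_vector_derivative_def has_derivative_at_alt by blast
    from this[rule_format, of "e/2"] \<open>e > 0\<close>
    obtain d where d: "d > 0" "\<And>s. \<bar>s - t\<bar> < d \<Longrightarrow> norm (k (cis s) - k (cis t)) \<le> e / 2 * \<bar>s - t\<bar>"
      by auto
    \<comment> \<open>The bound 1/2 allows the estimate |Ln u| \<le> 2 |u - 1| for the rotated point
      u = z / \<zeta>. The bound \<open>d/2\<close> then keeps its angle \<open>Arg u\<close> within
      \<open>d\<close>.\<close>
    show ?thesis
    proof (intro exI[of _ "min (1/2) (d/2)"] conjI allI impI)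
      fix z assume z: "norm z = 1 \<and> dist z \<zeta> < min (1/2) (d/2)"
      define u where "u = z / \<zeta>"
      have "u - 1 = (z - \<zeta>) / \<zeta>" using \<zeta> by (auto simp: u_def diff_divide_distrib)
      then have u1: "norm (u - 1) = dist z \<zeta>" using \<zeta> by (simp add: norm_divide dist_norm)
      have nu: "norm u = 1" using z \<zeta> by (simp add: u_def norm_divide)
      have "norm (Ln u) \<le> 2 * dist z \<zeta>"
        using norm_Ln_le[of "u - 1"] u1 z by simp
      then have th: "\<bar>Arg u\<bar> \<le> 2 * dist z \<zeta>"
        using abs_Im_le_cmod[of "Ln u"] nu by (auto simp: Arg_def)
      have "cis (Arg u) = u" using nu cis_Arg[of u] by (cases "u = 0") (auto simp: sgn_eq)
      then have zc: "z = cis (t + Arg u)" using \<zeta> by (auto simp: cis_mult[symmetric] u_def \<zeta>_def)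
      have "norm (k z - k \<zeta>) \<le> e / 2 * \<bar>Arg u\<bar>"
        using d(2)[of "t + Arg u"] th z by (simp add: zc[symmetric] \<zeta>_def)
      also have "\<dots> \<le> e / 2 * (2 * dist z \<zeta>)" using th \<open>e > 0\<close> by (intro mult_left_mono) auto
      finally show "norm (k z) \<le> e * dist z \<zeta>" by (simp add: k_def)
    qed (use d in auto)
  qed
  have "(g \<longlongrightarrow> l) (at \<zeta> within approach_region \<alpha> \<zeta>)" if "\<alpha> > 1" for \<alpha>
    unfolding Lim_within
  proof (intro allI impI)
    fix e :: real assume "e > 0"
    \<comment> \<open>Cauchy's estimate below costs the factor 2 \<alpha> + 1; the further 2 makes
      the final inequality strict.\<close>
    define e' where "e' = e / (2 * (2 * \<alpha> + 1))"
    have "e' > 0" using \<open>e > 0\<close> that by (simp add: e'_def)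
    from holomorphic_little_o_at_boundary_point[OF contk holk \<zeta> kC small this]
    obtain \<eta> where \<eta>: "\<eta> > 0" "\<And>z. z \<in> ball 0 1 \<Longrightarrow> dist z \<zeta> < \<eta> \<Longrightarrow> norm (k z) \<le> e' * dist z \<zeta>"
      by blast
    show "\<exists>d>0. \<forall>z\<in>approach_region \<alpha> \<zeta>. 0 < dist z \<zeta> \<and> dist z \<zeta> < d \<longrightarrow> dist (g z) l < e"
    proof (intro exI[of _ "\<eta>/2"] conjI ballI impI)
      fix z assume z: "z \<in> approach_region \<alpha> \<zeta>" "0 < dist z \<zeta> \<and> dist z \<zeta> < \<eta>/2"
      \<comment> \<open>With half the distance from \<open>z\<close> to the unit circle as radius,
        the disc about \<open>z\<close> stays inside the unit disc. Its points lie within 2 \<alpha>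
        r + r of \<open>\<zeta>\<close>, and within \<open>\<eta>\<close> because r \<le> |z -
        \<zeta>| < \<eta>/2.\<close>
      define r where "r = (1 - norm z) / 2"
      have r2: "1 - norm z = 2 * r" by (simp add: r_def)
      have zb: "z \<in> ball 0 1" and zd: "dist z \<zeta> < \<alpha> * (2 * r)"
        using z unfolding approach_region_def r2[symmetric] by auto
      have "r > 0" using zb by (simp add: r_def)
      have sub: "cball z r \<subseteq> ball 0 1"
      proof
        fix w assume "w \<in> cball z r"
        then have "norm w \<le> norm z + r"
          using norm_triangle_ineq2[of w z] by (auto simp: dist_norm norm_minus_commute)
        then show "w \<in> ball 0 1" using zb by (simp add: r_def field_simps)
      qed
      have rz: "r \<le> dist z \<zeta>"
      proof -
        have "1 - norm z \<le> dist z \<zeta>" using norm_triangle_ineq2[of \<zeta> z] \<zeta> by (simp add: dist_norm norm_minus_commute)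
        then show ?thesis using \<open>r > 0\<close> by (simp add: r_def)
      qed
      have "norm ((deriv ^^ 1) k z) \<le> fact 1 * (e' * (\<alpha> * (2 * r) + r)) / r ^ 1"
      proof (rule Cauchy_inequality)
        show "k holomorphic_on ball z r" using holk sub ball_subset_cball holomorphic_on_subset by blast
        show "continuous_on (cball z r) k"
          using contk sub ball_subset_cball continuous_on_subset by blast
        fix w assume w: "norm (z - w) = r"
        then have "w \<in> ball 0 1" using sub by (auto simp: dist_norm)
        have "dist w \<zeta> \<le> r + dist z \<zeta>" using w dist_triangle[of w \<zeta> z] by (simp add: dist_norm norm_minus_commute)
        then have "dist w \<zeta> < \<eta>" "dist w \<zeta> \<le> \<alpha> * (2 * r) + r" using rz z zd by auto
        then have "norm (k w) \<le> e' * dist w \<zeta>" using \<eta>(2)[OF \<open>w \<in> ball 0 1\<close>] by blast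
        also have "\<dots> \<le> e' * (\<alpha> * (2 * r) + r)"
          using \<open>e' > 0\<close> \<open>dist w \<zeta> \<le> \<alpha> * (2 * r) + r\<close> by (intro mult_left_mono) auto
        finally show "norm (k w) \<le> e' * (\<alpha> * (2 * r) + r)" .
      qed (use \<open>r > 0\<close> in auto)
      also have "\<dots> = e' * (2 * \<alpha> + 1)" using \<open>r > 0\<close> by (simp add: field_simps)
      also have "\<dots> = e / 2" using that by (simp add: e'_def divide_simps)
      also have "\<dots> < e" using \<open>e > 0\<close> by simp
      finally show "dist (g z) l < e" using DERIV_imp_deriv[OF derivk[OF zb]] by (simp add: dist_norm)
    qed (use \<eta> in auto)
  qed
  then show ?thesis unfolding \<zeta>_def by blast
qed

lemma dist_cis_le: "dist (cis s) (cis t) \<le> \<bar>s - t\<bar>"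
proof -
  have "norm (cis s - cis t) \<le> 1 * norm (s - t)"
  proof (rule differentiable_bound[of UNIV cis "\<lambda>x h. h *\<^sub>R (\<i> * cis x)"])
    fix x :: real
    show "(cis has_derivative (\<lambda>h. h *\<^sub>R (\<i> * cis x))) (at x within UNIV)"
      by (rule has_derivative_eq_rhs[OF has_derivative_cis[OF has_derivative_ident]])
         (simp add: fun_eq_iff scaleR_conv_of_real mult_ac)
    show "onorm (\<lambda>h. h *\<^sub>R (\<i> * cis x)) \<le> 1"
      by (rule onorm_le) (simp add: norm_mult)
  qed auto
  then show ?thesis by (simp add: dist_norm)
qed

theorem Fatou_bounded_disc:
  fixes g :: "complex \<Rightarrow> complex"
  assumes holg: "g holomorphic_on ball 0 1" and bdd: "bounded (g ` ball 0 1)"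
  shows "negligible {t. \<nexists>l. \<forall>\<alpha>>1. (g \<longlongrightarrow> l) (at (cis t) within approach_region \<alpha> (cis t))}"
proof -
  obtain M where M: "M \<ge> 0" "\<And>z. z \<in> ball 0 1 \<Longrightarrow> norm (g z) \<le> M"
    using bdd by (metis bounded_pos image_eqI less_imp_le)
  obtain G0 where "\<And>z. z \<in> ball 0 1 \<Longrightarrow> (G0 has_field_derivative g z) (at z within ball 0 1)"
    using holomorphic_convex_primitive'[OF convex_ball open_ball holg] by blast
  note G0 = this
  \<comment> \<open>The primitive has derivative bounded by \<open>M\<close> on a convex set; being
    Lipschitz, it extends to the closed disc with the same constant.\<close>
  have "M-lipschitz_on (ball 0 1) G0"
    using field_differentiable_bound[OF convex_ball G0 M(2)] M(1)
    by (auto simp: lipschitz_on_def dist_norm)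
  then obtain G where G: "M-lipschitz_on (closure (ball 0 1)) G" "\<And>z. z \<in> ball 0 1 \<Longrightarrow> G z = G0 z"
    using lipschitz_extend_closure by metis
  have lip: "M-lipschitz_on (cball 0 1) G" using G(1) by simp
  have derivG: "(G has_field_derivative g z) (at z)" if "z \<in> ball 0 1" for z
  proof (rule has_field_derivative_transform_within_open[OF _ open_ball that])
    show "(G0 has_field_derivative g z) (at z)" using G0[OF that] that at_within_open[OF that] by simp
  qed (simp add: G(2))
  have lip_t: "norm (G (cis s) - G (cis t)) \<le> M * \<bar>s - t\<bar>" for s t
  proof -
    have "norm (G (cis s) - G (cis t)) \<le> M * dist (cis s) (cis t)"
      using lipschitz_onD[OF lip, of "cis s" "cis t"] by (simp add: dist_norm)
    also have "\<dots> \<le> M * \<bar>s - t\<bar>" using dist_cis_le M(1) by (rule mult_left_mono)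
    finally show ?thesis .
  qed
  have "M-lipschitz_on UNIV (\<lambda>t. Re (G (cis t)))" "M-lipschitz_on UNIV (\<lambda>t. Im (G (cis t)))"
    using M(1) lip_t order_trans[OF abs_Re_le_cmod lip_t] order_trans[OF abs_Im_le_cmod lip_t]
    by (auto simp: lipschitz_on_def dist_real_def)
  then have "negligible ({t. \<not> (\<lambda>t. Re (G (cis t))) differentiable (at t)} \<union> {t. \<not> (\<lambda>t. Im (G (cis t))) differentiable (at t)})"
    by (intro negligible_Un lipschitz_differentiable_AE)
  then show ?thesis
  proof (rule negligible_subset, safe)
    fix t
    assume no: "\<nexists>l. \<forall>\<alpha>>1. (g \<longlongrightarrow> l) (at (cis t) within approach_region \<alpha> (cis t))"
      and "(\<lambda>t. Re (G (cis t))) differentiable (at t)" "(\<lambda>t. Im (G (cis t))) differentiable (at t)"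
    then obtain a b where "((\<lambda>t. Re (G (cis t))) has_real_derivative a) (at t)"
       "((\<lambda>t. Im (G (cis t))) has_real_derivative b) (at t)"
      by (auto simp: real_differentiable_def)
    then have "((\<lambda>t. G (cis t)) has_vector_derivative Complex a b) (at t)"
      by (simp add: has_vector_derivative_complex_iff)
    from nontangential_limit_of_derivative[OF lip derivG this] no show False by blast
  qed
qed

section \<open>The Cauchy formula for boundary values\<close>

text \<open>Makes non-tangential limits unique, so that the \<open>THE\<close> in
  \<open>boundary_value\<close> can be evaluated. A radial point (1 - r) \<zeta> has distance r both
  from \<open>\<zeta>\<close> and from the circle, so every aperture above 1 admits it.\<close>

lemma at_within_approach_region_neq_bot:
  assumes "norm \<zeta> = 1" "\<alpha> > 1"
  shows "at \<zeta> within approach_region \<alpha> \<zeta> \<noteq> bot"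
proof -
  have "\<zeta> islimpt approach_region \<alpha> \<zeta>"
    unfolding islimpt_approachable
  proof (intro allI impI)
    fix e :: real assume "e > 0"
    define r where "r = min (1/2) (e/2)"
    have r: "0 < r" "r \<le> 1/2" "r < e" using \<open>e > 0\<close> by (auto simp: r_def)
    define z where "z = of_real (1 - r) * \<zeta>"
    have "z - \<zeta> = of_real (- r) * \<zeta>" by (simp add: z_def algebra_simps)
    then have d: "dist z \<zeta> = r" using r assms unfolding dist_norm by (simp add: norm_mult)
    have "norm z = 1 - r" using r assms unfolding z_def norm_mult norm_of_real by simp
    then have "z \<in> approach_region \<alpha> \<zeta>" using d r assms by (simp add: approach_region_def)
    moreover have "z \<noteq> \<zeta>" "dist z \<zeta> < e" using d r by auto
    ultimately show "\<exists>z\<in>approach_region \<alpha> \<zeta>. z \<noteq> \<zeta> \<and> dist z \<zeta> < e" by blast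
  qed
  then show ?thesis by (simp add: trivial_limit_within)
qed

lemma boundary_value_eqI:
  assumes "norm \<zeta> = 1" "\<And>\<alpha>. \<alpha> > 1 \<Longrightarrow> (g \<longlongrightarrow> l) (at \<zeta> within approach_region \<alpha> \<zeta>)"
  shows "boundary_value g \<zeta> = l"
  unfolding boundary_value_def
proof (rule the_equality)
  fix l' assume "\<forall>\<alpha>>1. (g \<longlongrightarrow> l') (at \<zeta> within approach_region \<alpha> \<zeta>)"
  then have "(g \<longlongrightarrow> l') (at \<zeta> within approach_region 2 \<zeta>)" by simp
  then show "l' = l"
    using tendsto_unique[OF at_within_approach_region_neq_bot[where \<alpha>=2, OF assms(1)]] assms(2)[of 2] by auto
qed (use assms in blast)

text \<open>Approach regions lie in the open disc, so the values of \<open>g\<close> elsewhere, in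
  particular at \<open>\<zeta>\<close>, do not affect the limit.\<close>

lemma boundary_value_eq_continuous:
  assumes "norm \<zeta> = 1" "isCont h \<zeta>" "\<And>z. z \<in> ball 0 1 \<Longrightarrow> g z = h z"
  shows "boundary_value g \<zeta> = h \<zeta>"
proof (rule boundary_value_eqI[OF assms(1)])
  fix \<alpha> :: real
  have "(h \<longlongrightarrow> h \<zeta>) (at \<zeta> within approach_region \<alpha> \<zeta>)"
    using assms(2) tendsto_within_subset[of h _ \<zeta> UNIV] by (simp add: isCont_def)
  then show "(g \<longlongrightarrow> h \<zeta>) (at \<zeta> within approach_region \<alpha> \<zeta>)"
    by (rule Lim_transform_eventually)
       (auto simp: eventually_at_filter approach_region_def assms(3))
qed

lemma nontangential_imp_radial_limit:
  assumes "norm \<zeta> = 1" and lim: "(g \<longlongrightarrow> l) (at \<zeta> within approach_region 2 \<zeta>)"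
    and r: "r \<longlonglongrightarrow> 1" "\<And>n. 0 < r n" "\<And>n. r n < 1"
  shows "(\<lambda>n. g (of_real (r n) * \<zeta>)) \<longlonglongrightarrow> l"
proof (rule filterlim_compose[OF lim])
  have lim1: "(\<lambda>n. of_real (r n) * \<zeta>) \<longlonglongrightarrow> of_real 1 * \<zeta>"
    by (intro tendsto_intros r)
  have "of_real (r n) * \<zeta> \<in> approach_region 2 \<zeta> \<and> of_real (r n) * \<zeta> \<noteq> \<zeta>" for n
  proof -
    have "of_real (r n) * \<zeta> - \<zeta> = of_real (r n - 1) * \<zeta>" by (simp add: algebra_simps)
    then have d: "dist (of_real (r n) * \<zeta>) \<zeta> = 1 - r n"
      using r(2,3)[of n] assms(1) unfolding dist_norm by (simp only: norm_mult norm_of_real) simp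
    have "norm (of_real (r n) * \<zeta>) = r n" using r(2)[of n] assms(1) by (simp add: norm_mult)
    then have "of_real (r n) * \<zeta> \<in> approach_region 2 \<zeta>" using d r(3)[of n] by (simp add: approach_region_def)
    moreover have "of_real (r n) * \<zeta> \<noteq> \<zeta>" using d r(3)[of n] by auto
    ultimately show ?thesis ..
  qed
  then show "filterlim (\<lambda>n. of_real (r n) * \<zeta>) (at \<zeta> within approach_region 2 \<zeta>) sequentially"
    using lim1 by (simp add: filterlim_at)
qed

text \<open>Cauchy's formula holds for the dilates g(r z), which are holomorphic on the closed disc.
  As r tends to 1 their values on the circle converge to the boundary values off a null set, and
  boundedness of \<open>g\<close> supplies the dominating function.\<close>

lemma Cauchy_formula_boundary_value:
  fixes g :: "complex \<Rightarrow> complex"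
  assumes holg: "g holomorphic_on ball 0 1" and bdd: "bounded (g ` ball 0 1)" and w: "w \<in> ball 0 1"
  shows "(LINT t:{0..2*pi}|lebesgue. cis t / (2 * of_real pi * (cis t - w)) * boundary_value g (cis t)) = g w"
proof -
  \<comment> \<open>Parametrising the circle by \<open>cis\<close> turns dz / (2 pi i (z - w)) into
    K(t) dt.\<close>
  define K where "K = (\<lambda>t. cis t / (2 * of_real pi * (cis t - w)))"
  obtain M where M: "M \<ge> 0" "\<And>z. z \<in> ball 0 1 \<Longrightarrow> norm (g z) \<le> M"
    using bdd by (metis bounded_pos image_eqI less_imp_le)
  have ne: "cis t \<noteq> w" for t using w norm_cis[of t] by (metis less_irrefl mem_ball_0)
  have contK: "continuous_on A K" for A
    unfolding K_def by (intro continuous_intros) (use ne in auto)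
  define N where "N = {t. \<nexists>l. \<forall>\<alpha>>1. (g \<longlongrightarrow> l) (at (cis t) within approach_region \<alpha> (cis t))}"
  have N: "negligible N" unfolding N_def by (rule Fatou_bounded_disc[OF holg bdd])
  have lim: "(g \<longlongrightarrow> boundary_value g (cis t)) (at (cis t) within approach_region 2 (cis t))" if tN: "t \<notin> N" for t
  proof -
    obtain l where l: "\<And>\<alpha>. \<alpha> > 1 \<Longrightarrow> (g \<longlongrightarrow> l) (at (cis t) within approach_region \<alpha> (cis t))"
      using tN unfolding N_def by blast
    show ?thesis using boundary_value_eqI[OF norm_cis l] l[of 2] by simp
  qed
  \<comment> \<open>The shift by 2 keeps the radii strictly between 0 and 1 from n = 0 on.\<close>
  define r where "r = (\<lambda>n. 1 - 1 / (real n + 2))"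
  have r: "r \<longlonglongrightarrow> 1" "\<And>n. 0 < r n" "\<And>n. r n < 1"
  proof -
    show "r \<longlonglongrightarrow> 1" unfolding r_def by real_asymp
  qed (auto simp: r_def)
  define f where "f = (\<lambda>n t. K t * g (of_real (r n) * cis t))"
  have in_ball: "of_real (r n) * z \<in> ball 0 1" if zz: "norm z \<le> 1" for n and z :: complex
  proof -
    have "r n * norm z \<le> r n * 1" using r(2)[of n] zz by (intro mult_left_mono) auto
    then have "r n * norm z < 1" using r(3)[of n] by linarith
    then show ?thesis using r(2)[of n] by (simp add: norm_mult)
  qed
  have contf: "continuous_on {0..2*pi} (f n)" for n
    unfolding f_def
    by (intro continuous_intros contK continuous_on_compose2[OF holomorphic_on_imp_continuous_on[OF holg]])
       (use in_ball in auto)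
  have bound: "norm (f n t) \<le> norm (K t) * M" for n t
    unfolding f_def norm_mult using M(2)[OF in_ball[of "cis t" n]] by (intro mult_left_mono) auto
  have intf: "integral {0..2*pi} (f n) = g (of_real (r n) * w)" for n
  proof -
    have hol: "(\<lambda>z. g (of_real (r n) * z)) holomorphic_on cball 0 1"
      by (rule holomorphic_on_compose_gen[unfolded o_def, OF _ holg])
         (use in_ball in \<open>auto intro!: holomorphic_intros\<close>)
    have "((\<lambda>u. g (of_real (r n) * u) / (u - w)) has_contour_integral (2 * of_real pi * \<i> * g (of_real (r n) * w)))
         (circlepath 0 1)"
      using Cauchy_integral_circlepath_simple[OF hol] w by simp
    then have "((\<lambda>t. g (of_real (r n) * (0 + of_real 1 * cis t)) / (0 + of_real 1 * cis t - w) * of_real 1 * \<i> * cis t)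
        has_integral (2 * of_real pi * \<i> * g (of_real (r n) * w))) {0..2*pi}"
      unfolding circlepath_def by (subst (asm) has_contour_integral_part_circlepath_iff) auto
    then have "((\<lambda>t. 1 / (2 * of_real pi * \<i>) * (g (of_real (r n) * (0 + of_real 1 * cis t)) / (0 + of_real 1 * cis t - w) * of_real 1 * \<i> * cis t))
        has_integral (1 / (2 * of_real pi * \<i>) * (2 * of_real pi * \<i> * g (of_real (r n) * w)))) {0..2*pi}"
      by (rule has_integral_mult_right)
    moreover have "1 / (2 * of_real pi * \<i>) * (g (of_real (r n) * (0 + of_real 1 * cis t)) / (0 + of_real 1 * cis t - w) * of_real 1 * \<i> * cis t) = f n t" for t
      by (simp add: f_def K_def)
    ultimately show ?thesis by (simp add: integral_unique)
  qed
  define b where "b = (\<lambda>t. K t * boundary_value g (cis t))"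
  \<comment> \<open>Integrands are set to 0 on the exceptional set, since the dominated convergence
    theorem used below asks for convergence at every point.\<close>
  define f' where "f' = (\<lambda>n t. if t \<in> N then 0 else f n t)"
  define b' where "b' = (\<lambda>t. if t \<in> N then 0 else b t)"
  have intK: "(\<lambda>t. norm (K t) * M) integrable_on {0..2*pi}"
    by (intro integrable_continuous_interval continuous_intros contK)
  have f'_int: "f' n integrable_on {0..2*pi}" for n
    by (rule integrable_spike[OF integrable_continuous_interval[OF contf] N]) (simp add: f'_def)
  have f'_le: "norm (f' n t) \<le> norm (K t) * M" for n t
    using bound[of n t] M(1) by (simp add: f'_def)
  have conv: "(\<lambda>n. f' n t) \<longlonglongrightarrow> b' t" for t
    unfolding f'_def b'_def f_def b_def using nontangential_imp_radial_limit[OF norm_cis lim r, of t]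
    by (cases "t \<in> N") (auto intro!: tendsto_intros)
  have b'_int: "b' integrable_on {0..2*pi}"
    and lim1: "(\<lambda>n. integral {0..2*pi} (f' n)) \<longlonglongrightarrow> integral {0..2*pi} b'"
    using dominated_convergence[of f' "{0..2*pi}" "\<lambda>t. norm (K t) * M" b', OF f'_int intK f'_le conv] by auto
  have "norm (b' t) \<le> norm (K t) * M" for t
    by (intro LIMSEQ_le_const2[OF tendsto_norm[OF conv]]) (use f'_le in auto)
  then have "b' absolutely_integrable_on {0..2*pi}"
    using b'_int intK by (intro absolutely_integrable_integrable_bound) auto
  then have "b absolutely_integrable_on {0..2*pi}"
    by (rule absolutely_integrable_spike[OF _ N]) (simp add: b'_def)
  then have "(LINT t:{0..2*pi}|lebesgue. b t) = integral {0..2*pi} b"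
    by (rule set_lebesgue_integral_eq_integral)
  also have "\<dots> = integral {0..2*pi} b'"
    by (rule integral_spike[OF N]) (simp add: b'_def)
  also have "\<dots> = g w"
  proof (rule LIMSEQ_unique[OF lim1])
    have "integral {0..2*pi} (f' n) = g (of_real (r n) * w)" for n
      unfolding intf[symmetric] by (rule integral_spike[OF N]) (simp add: f'_def)
    moreover have "(\<lambda>n. g (of_real (r n) * w)) \<longlonglongrightarrow> g (of_real 1 * w)"
    proof (rule isCont_tendsto_compose[where g=g])
      show "isCont g (of_real 1 * w)"
        using holg w continuous_on_eq_continuous_at[OF open_ball] holomorphic_on_imp_continuous_on by fastforce
    qed (intro tendsto_intros r)
    ultimately show "(\<lambda>n. integral {0..2*pi} (f' n)) \<longlonglongrightarrow> g w" by simp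
  qed
  finally show ?thesis unfolding b_def K_def .
qed

lemma cauchy_kernel_in_L1_circle:
  assumes "w \<in> ball 0 1"
  shows "(\<lambda>\<zeta>. \<zeta> / (2 * of_real pi * (\<zeta> - w))) \<in> L1_circle"
proof -
  have "cis t \<noteq> w" for t using assms norm_cis[of t] by (metis less_irrefl mem_ball_0)
  then show ?thesis
    unfolding L1_circle_def
    by (auto intro!: absolutely_integrable_continuous_real continuous_intros)
qed

section \<open>Weak topology and characters\<close>

text \<open>The sets that eventually contain the sequence once they contain \<open>l\<close> are
  closed under finite intersections and unions. Only subbasic sets need checking, and there the
  claim is convergence of a single functional.\<close>

lemma limitin_weak_topology:
  assumes f: "\<And>n. f n \<in> Hinf \<Omega>" and l: "l \<in> Hinf \<Omega>"
    and lim: "\<And>F. F \<in> L1_circle \<Longrightarrow> (\<lambda>n. predual_functional \<phi> F (f n)) \<longlonglongrightarrow> predual_functional \<phi> F l"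
  shows "limitin (weak_topology \<Omega> \<phi>) f l sequentially"
proof -
  have "l \<in> U \<longrightarrow> (\<forall>\<^sub>F n in sequentially. f n \<in> U)"
    if "generate_topology_on {{f \<in> Hinf \<Omega>. \<Lambda> f \<in> U} | \<Lambda> U. \<Lambda> \<in> Hinf_predual \<phi> \<and> open U} U" for U
    using that
  proof (induction rule: generate_topology_on.induct)
    case (Int a b)
    then show ?case by (auto intro: eventually_conj)
  next
    case (UN K)
    show ?case
    proof
      assume "l \<in> \<Union>K"
      then obtain k where "k \<in> K" "l \<in> k" by blast
      then have "\<forall>\<^sub>F n in sequentially. f n \<in> k" using UN.IH by blast
      then show "\<forall>\<^sub>F n in sequentially. f n \<in> \<Union>K"
        by (rule eventually_mono) (use \<open>k \<in> K\<close> in blast)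
    qed
  next
    case (Basis s)
    then obtain F U where s: "s = {f \<in> Hinf \<Omega>. predual_functional \<phi> F f \<in> U}" "F \<in> L1_circle" "open U"
      by (auto simp: Hinf_predual_def)
    then show ?case using topological_tendstoD[OF lim[OF s(2)] s(3)] f by simp
  qed simp
  then show ?thesis
    using l unfolding limitin_def topspace_weak_topology
    unfolding weak_topology_def openin_topology_generated_by_iff by blast
qed

section \<open>Weak decay of the powers of a peak function\<close>

lemma AE_cis_neq: "AE t in lebesgue. cis t \<noteq> w"
proof -
  have "countable {t. cis t = w}"
  proof (cases "\<exists>t0. cis t0 = w")
    case True
    then obtain t0 where "cis t0 = w" by blast
    then have "{t. cis t = w} \<subseteq> range (\<lambda>n::int. t0 + 2 * pi * n)"
      using sin_cos_eq_iff[of _ t0] by (auto simp: complex_eq_iff)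
    then show ?thesis by (rule countable_subset) simp
  qed auto
  then have "{t. cis t = w} \<in> null_sets lebesgue"
    by (metis countable_imp_null_set_lborel null_sets_completionI)
  then show ?thesis by (rule AE_I') auto
qed

text \<open>The base has modulus at most 1, and less than 1 except where \<open>cis t = w\<close>, a
  null set. Dominated convergence applies with |F| as majorant.\<close>

lemma peak_power_integral_tendsto_0:
  assumes F: "F \<in> L1_circle" and w: "norm w \<ge> 1"
  shows "(\<lambda>n. LINT t:{0..2*pi}|lebesgue. F (cis t) * ((1 + cis t / w) / 2) ^ n) \<longlonglongrightarrow> 0"
proof -
  have "(\<lambda>n. LINT t|lebesgue. indicator {0..2*pi} t *\<^sub>R (F (cis t) * ((1 + cis t / w) / 2) ^ n))
      \<longlonglongrightarrow> (LINT t::real|lebesgue. (0::complex))"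
  proof (rule integral_dominated_convergence)
    define F' where "F' = (\<lambda>t. indicator {0..2*pi} t *\<^sub>R F (cis t))"
    have F': "integrable lebesgue F'" using F by (simp add: L1_circle_def set_integrable_def F'_def)
    show "integrable lebesgue (\<lambda>t. norm (F' t))" using F' by (rule integrable_norm)
    have le1: "norm ((1 + cis t / w) / 2) \<le> 1" for t
    proof -
      have "norm (1 + cis t / w) \<le> 1 + norm (cis t / w)" by (metis norm_one norm_triangle_ineq)
      also have "\<dots> \<le> 2" using w by (simp add: norm_divide divide_le_eq)
      finally show ?thesis by (simp add: norm_divide)
    qed
    have eq: "indicator {0..2*pi} t *\<^sub>R (F (cis t) * ((1 + cis t / w) / 2) ^ n) = F' t * ((1 + cis t / w) / 2) ^ n" for t n
      by (simp add: F'_def)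
    have "(\<lambda>t. ((1 + cis t / w) / 2) ^ n) \<in> borel_measurable borel" for n
      by (intro borel_measurable_continuous_onI continuous_intros) (use w in auto)
    then have "(\<lambda>t. ((1 + cis t / w) / 2) ^ n) \<in> borel_measurable lebesgue" for n
      by (intro measurable_completion) simp
    then show "(\<lambda>t. indicator {0..2*pi} t *\<^sub>R (F (cis t) * ((1 + cis t / w) / 2) ^ n)) \<in> borel_measurable lebesgue" for n
      unfolding eq using F' by (intro borel_measurable_times) auto
    show "AE t in lebesgue. norm (indicator {0..2*pi} t *\<^sub>R (F (cis t) * ((1 + cis t / w) / 2) ^ n)) \<le> norm (F' t)" for n
      unfolding eq norm_mult norm_power
      by (intro AE_I2 mult_right_le_one_le) (use le1 in \<open>auto intro!: power_le_one\<close>)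
    show "AE t in lebesgue. (\<lambda>n. indicator {0..2*pi} t *\<^sub>R (F (cis t) * ((1 + cis t / w) / 2) ^ n)) \<longlonglongrightarrow> 0"
      using AE_cis_neq[of w]
    proof eventually_elim
      case (elim t)
      \<comment> \<open>Modulus 1 would be the equality case of the triangle inequality, forcing
        \<open>cis t / w\<close> to be a nonnegative real of modulus 1, hence
        \<open>cis t = w\<close>.\<close>
      have "norm ((1 + cis t / w) / 2) < 1"
      proof (rule ccontr)
        assume "\<not> ?thesis"
        then have "norm (1 + cis t / w) \<ge> 2" by (simp add: norm_divide)
        moreover have "norm (cis t / w) \<le> 1" using w by (simp add: norm_divide divide_le_eq)
        moreover have "norm (1 + cis t / w) \<le> 1 + norm (cis t / w)" by (metis norm_one norm_triangle_ineq)
        ultimately have n: "norm (1 + cis t / w) = 1 + norm (cis t / w)" "norm (cis t / w) = 1" by linarith+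
        then have "cis t / w = 1" using norm_triangle_eq[of 1 "cis t / w"] by (simp add: scaleR_conv_of_real)
        then show False using elim w by auto
      qed
      then have "(\<lambda>n. F' t * ((1 + cis t / w) / 2) ^ n) \<longlonglongrightarrow> F' t * 0"
        by (intro tendsto_intros LIMSEQ_power_zero)
      then show ?case unfolding eq by simp
    qed
  qed simp
  then show ?thesis by (simp add: set_lebesgue_integral_def)
qed

section \<open>The algebra operations and the involution on bounded holomorphic functions\<close>

lemma HinfI:
  assumes "f holomorphic_on \<Omega>" "\<And>z. z \<in> \<Omega> \<Longrightarrow> norm (f z) \<le> B" "\<And>z. z \<notin> \<Omega> \<Longrightarrow> f z = 0"
  shows "f \<in> Hinf \<Omega>"
  using assms unfolding Hinf_def bounded_iff by blast

lemma HinfE: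
  assumes "f \<in> Hinf \<Omega>"
  obtains B where "f holomorphic_on \<Omega>" "B \<ge> 0" "\<And>z. z \<in> \<Omega> \<Longrightarrow> norm (f z) \<le> B" "\<And>z. z \<notin> \<Omega> \<Longrightarrow> f z = 0"
proof -
  obtain B where "B > 0" "\<forall>x\<in>f ` \<Omega>. norm x \<le> B"
    using assms unfolding Hinf_def bounded_pos by blast
  with assms show thesis by (intro that[of B]) (auto simp: Hinf_def)
qed

lemma Hinf_add:
  assumes "f \<in> Hinf \<Omega>" "g \<in> Hinf \<Omega>"
  shows "(\<lambda>z. f z + g z) \<in> Hinf \<Omega>"
proof -
  obtain B where B: "f holomorphic_on \<Omega>" "B \<ge> 0" "\<And>z. z \<in> \<Omega> \<Longrightarrow> norm (f z) \<le> B" "\<And>z. z \<notin> \<Omega> \<Longrightarrow> f z = 0"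
    using HinfE[OF assms(1)] by blast
  obtain C where C: "g holomorphic_on \<Omega>" "C \<ge> 0" "\<And>z. z \<in> \<Omega> \<Longrightarrow> norm (g z) \<le> C" "\<And>z. z \<notin> \<Omega> \<Longrightarrow> g z = 0"
    using HinfE[OF assms(2)] by blast
  show ?thesis
    by (rule HinfI[of _ _ "B + C"]) (auto intro!: holomorphic_intros norm_triangle_mono B C simp: B(4) C(4))
qed

lemma Hinf_mult:
  assumes "f \<in> Hinf \<Omega>" "g \<in> Hinf \<Omega>"
  shows "(\<lambda>z. f z * g z) \<in> Hinf \<Omega>"
proof -
  obtain B where B: "f holomorphic_on \<Omega>" "B \<ge> 0" "\<And>z. z \<in> \<Omega> \<Longrightarrow> norm (f z) \<le> B" "\<And>z. z \<notin> \<Omega> \<Longrightarrow> f z = 0"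
    using HinfE[OF assms(1)] by blast
  obtain C where C: "g holomorphic_on \<Omega>" "C \<ge> 0" "\<And>z. z \<in> \<Omega> \<Longrightarrow> norm (g z) \<le> C" "\<And>z. z \<notin> \<Omega> \<Longrightarrow> g z = 0"
    using HinfE[OF assms(2)] by blast
  show ?thesis
    by (rule HinfI[of _ _ "B * C"]) (auto intro!: holomorphic_intros mult_mono B C simp: B(4) norm_mult)
qed

lemma Hinf_scale:
  assumes "f \<in> Hinf \<Omega>"
  shows "(\<lambda>z. c * f z) \<in> Hinf \<Omega>"
proof -
  obtain B where B: "f holomorphic_on \<Omega>" "B \<ge> 0" "\<And>z. z \<in> \<Omega> \<Longrightarrow> norm (f z) \<le> B" "\<And>z. z \<notin> \<Omega> \<Longrightarrow> f z = 0"
    using HinfE[OF assms(1)] by blast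
  show ?thesis
    by (rule HinfI[of _ _ "norm c * B"]) (auto intro!: holomorphic_intros mult_left_mono B simp: B(4) norm_mult)
qed

lemma Hinf_compose:
  assumes "h holomorphic_on \<Omega>" "h ` \<Omega> \<subseteq> D" "g holomorphic_on D" "\<And>z. z \<in> D \<Longrightarrow> norm (g z) \<le> B"
  shows "(\<lambda>z. if z \<in> \<Omega> then g (h z) else 0) \<in> Hinf \<Omega>"
proof (rule HinfI[of _ _ B])
  have "g \<circ> h holomorphic_on \<Omega>"
    by (rule holomorphic_on_compose_gen[OF assms(1,3,2)])
  then show "(\<lambda>z. if z \<in> \<Omega> then g (h z) else 0) holomorphic_on \<Omega>"
    by (rule holomorphic_transform) auto
qed (use assms in auto)

lemma Hinf_one_in: "Hinf_one \<Omega> \<in> Hinf \<Omega>"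
  using Hinf_compose[of "\<lambda>_. 0" \<Omega> UNIV "\<lambda>_. 1" 1] by (simp add: Hinf_one_def)

text \<open>On \<Omega> the function is \<open>cnj \<circ> f \<circ> cnj\<close> after
  \<open>\<lambda>z. cnj (\<sigma> z)\<close>, a composition of two holomorphic maps.\<close>

lemma sharp_in_Hinf:
  assumes "open \<Omega>" "antiholomorphic_involution \<Omega> \<sigma>" "f \<in> Hinf \<Omega>"
  shows "sharp \<Omega> \<sigma> f \<in> Hinf \<Omega>"
proof -
  obtain B where B: "f holomorphic_on \<Omega>" "B \<ge> 0" "\<And>z. z \<in> \<Omega> \<Longrightarrow> norm (f z) \<le> B" "\<And>z. z \<notin> \<Omega> \<Longrightarrow> f z = 0"
    using HinfE[OF assms(3)] by blast
  have \<sigma>: "\<sigma> ` \<Omega> \<subseteq> \<Omega>" "(\<lambda>z. cnj (\<sigma> z)) holomorphic_on \<Omega>"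
    using assms(2) by (auto simp: antiholomorphic_involution_def)
  have "open (cnj ` \<Omega>)"
    unfolding image_cnj_conv_vimage_cnj using assms(1) by (intro open_vimage) auto
  then have "cnj \<circ> f \<circ> cnj holomorphic_on cnj ` \<Omega>"
    by (intro holomorphic_on_compose_cnj_cnj) (simp_all add: image_image B(1))
  then have "(\<lambda>z. if z \<in> \<Omega> then (cnj \<circ> f \<circ> cnj) (cnj (\<sigma> z)) else 0) \<in> Hinf \<Omega>"
    by (rule Hinf_compose[OF \<sigma>(2), rotated, where B=B]) (use \<sigma>(1) B(3) in auto)
  then show ?thesis by (simp add: sharp_def cong: if_cong)
qed

lemma point_eval_star_hom:
  assumes "open \<Omega>" "antiholomorphic_involution \<Omega> \<sigma>" "w \<in> \<Omega>" "\<sigma> w = w"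
  shows "star_hom \<Omega> \<sigma> (point_eval \<Omega> w)"
  unfolding star_hom_def algebra_hom_def point_eval_def
  using assms sharp_in_Hinf[OF assms(1,2)]
  by (auto simp: Hinf_add Hinf_mult Hinf_scale Hinf_one_in) (auto simp: Hinf_one_def sharp_def)

section \<open>Passage to the disc and weak continuity of point evaluations\<close>

lemma biholomorphic_map_disc_coordinate:
  assumes "biholomorphic_map (ball 0 1) \<Omega> \<phi>" "z \<in> \<Omega>"
  shows "inv_into (ball 0 1) \<phi> z \<in> ball 0 1" "\<phi> (inv_into (ball 0 1) \<phi> z) = z"
  using assms by (auto simp: biholomorphic_map_def bij_betw_def f_inv_into_f intro: inv_into_into)

lemma Hinf_pullback_disc:
  assumes "biholomorphic_map (ball 0 1) \<Omega> \<phi>" "f \<in> Hinf \<Omega>"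
  shows "(f \<circ> \<phi>) holomorphic_on ball 0 1" "bounded ((f \<circ> \<phi>) ` ball 0 1)"
proof -
  have "\<phi> holomorphic_on ball 0 1" "\<phi> ` ball 0 1 = \<Omega>"
    using assms(1) by (auto simp: biholomorphic_map_def bij_betw_def)
  moreover have "f holomorphic_on \<Omega>" "bounded (f ` \<Omega>)" using assms(2) by (auto simp: Hinf_def)
  ultimately show "(f \<circ> \<phi>) holomorphic_on ball 0 1" "bounded ((f \<circ> \<phi>) ` ball 0 1)"
    by (auto intro: holomorphic_on_compose_gen simp only: image_comp[symmetric])
qed

text \<open>Evaluation at \<open>w\<close> agrees on \<open>Hinf \<Omega>\<close> with one predual
  functional, whose density is the Cauchy kernel at the preimage \<open>u\<close> of
  \<open>w\<close>. Preimages of open sets are therefore subbasic.\<close>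

lemma point_eval_weakly_continuous:
  assumes \<phi>: "biholomorphic_map (ball 0 1) \<Omega> \<phi>" and w: "w \<in> \<Omega>"
  shows "continuous_map (weak_topology \<Omega> \<phi>) euclidean (point_eval \<Omega> w)"
proof -
  define u where "u = inv_into (ball 0 1) \<phi> w"
  have u: "u \<in> ball 0 1" "\<phi> u = w"
    using biholomorphic_map_disc_coordinate[OF \<phi> w] by (simp_all add: u_def)
  define F where "F = (\<lambda>\<zeta>. \<zeta> / (2 * of_real pi * (\<zeta> - u)))"
  have F: "predual_functional \<phi> F \<in> Hinf_predual \<phi>"
    unfolding Hinf_predual_def F_def by (rule imageI) (rule cauchy_kernel_in_L1_circle[OF u(1)])
  have eq: "predual_functional \<phi> F f = f w" if "f \<in> Hinf \<Omega>" for f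
    using Cauchy_formula_boundary_value[OF Hinf_pullback_disc[OF \<phi> that] u(1)] u(2)
    by (simp add: predual_functional_def F_def)
  show ?thesis
    unfolding continuous_map topspace_weak_topology
  proof (intro conjI allI impI)
    fix U :: "complex set" assume "openin euclidean U"
    then have "open U" by simp
    have "{f \<in> Hinf \<Omega>. point_eval \<Omega> w f \<in> U} = {f \<in> Hinf \<Omega>. predual_functional \<phi> F f \<in> U}"
      using eq by (auto simp: point_eval_def)
    then show "openin (weak_topology \<Omega> \<phi>) {f \<in> Hinf \<Omega>. point_eval \<Omega> w f \<in> U}"
      unfolding weak_topology_def using F \<open>open U\<close> by (auto intro!: topology_generated_by_Basis)
  qed simp
qed

section \<open>Weakly continuous characters as point evaluations\<close>

lemma bounded_difference_quotient:
  fixes g :: "complex \<Rightarrow> complex"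
  assumes holg: "g holomorphic_on ball 0 1" and bdd: "\<And>z. z \<in> ball 0 1 \<Longrightarrow> norm (g z) \<le> B" and w: "w \<in> ball 0 1"
  obtains h C where "h holomorphic_on ball 0 1" "\<And>z. z \<in> ball 0 1 \<Longrightarrow> norm (h z) \<le> C"
    "\<And>z. g z - g w = (z - w) * h z"
proof -
  define h where "h = (\<lambda>z. if z = w then deriv g w else (g z - g w) / (z - w))"
  have holh: "h holomorphic_on ball 0 1"
    unfolding h_def by (rule pole_lemma_open[OF holg open_ball])
  have factor: "g z - g w = (z - w) * h z" for z by (simp add: h_def)
  \<comment> \<open>Half the distance from \<open>w\<close> to the circle. On the closed disc of
    this radius compactness bounds \<open>h\<close>; outside it the numerator is at most
    \<open>2 * B\<close> and the denominator at least \<open>e\<close>.\<close>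
  define e where "e = (1 - norm w) / 2"
  have "e > 0" using w by (simp add: e_def)
  have sub: "cball w e \<subseteq> ball 0 1"
  proof
    fix z assume "z \<in> cball w e"
    then have "norm z \<le> norm w + e"
      using norm_triangle_ineq2[of z w] by (auto simp: dist_norm norm_minus_commute)
    also have "\<dots> < 1" using w by (simp add: e_def field_simps)
    finally show "z \<in> ball 0 1" by simp
  qed
  have "compact (h ` cball w e)"
    using holomorphic_on_imp_continuous_on[OF holomorphic_on_subset[OF holh sub]]
    by (intro compact_continuous_image) auto
  then obtain C where C: "\<And>z. z \<in> cball w e \<Longrightarrow> norm (h z) \<le> C"
    using compact_imp_bounded bounded_iff by (metis image_eqI)
  have "norm (h z) \<le> max C (2 * B / e)" if z: "z \<in> ball 0 1" for z
  proof (cases "z \<in> cball w e")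
    case True
    then show ?thesis using C by (simp add: max.coboundedI1)
  next
    case False
    then have far: "e \<le> norm (z - w)" by (simp add: dist_norm norm_minus_commute)
    have "norm (g z - g w) \<le> 2 * B"
      using norm_triangle_ineq4[of "g z" "g w"] bdd[OF z] bdd[OF w] by simp
    then have "norm (g z - g w) / norm (z - w) \<le> 2 * B / e"
      using far \<open>e > 0\<close> order_trans[OF norm_ge_zero bdd[OF w]] by (intro frac_le) auto
    moreover have "h z = (g z - g w) / (z - w)" using far \<open>e > 0\<close> by (auto simp: h_def)
    ultimately show ?thesis by (simp add: norm_divide max.coboundedI2)
  qed
  with holh factor show thesis using that by blast
qed

text \<open>The counterpart in \<open>Hinf \<Omega>\<close> of the coordinate function z of the
  disc; a character is determined by testing it on this element.\<close>

definition disc_coordinate :: "complex set \<Rightarrow> (complex \<Rightarrow> complex) \<Rightarrow> complex \<Rightarrow> complex" where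
  "disc_coordinate \<Omega> \<phi> = (\<lambda>z. if z \<in> \<Omega> then inv_into (ball 0 1) \<phi> z else 0)"

lemma disc_coordinate_in_Hinf:
  assumes \<phi>: "biholomorphic_map (ball 0 1) \<Omega> \<phi>"
  shows "disc_coordinate \<Omega> \<phi> \<in> Hinf \<Omega>"
proof -
  have "inv_into (ball 0 1) \<phi> holomorphic_on \<Omega>" using \<phi> by (simp add: biholomorphic_map_def)
  then show ?thesis
    unfolding disc_coordinate_def
    by (rule Hinf_compose[where g="\<lambda>z. z" and B=1 and D="ball 0 1"])
       (use biholomorphic_map_disc_coordinate[OF \<phi>] in auto)
qed

lemma algebra_homD:
  assumes "algebra_hom \<Omega> \<psi>" "f \<in> Hinf \<Omega>"
  shows "g \<in> Hinf \<Omega> \<Longrightarrow> \<psi> (\<lambda>z. f z + g z) = \<psi> f + \<psi> g"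
    and "\<psi> (\<lambda>z. c * f z) = c * \<psi> f"
    and "g \<in> Hinf \<Omega> \<Longrightarrow> \<psi> (\<lambda>z. f z * g z) = \<psi> f * \<psi> g"
    and "\<psi> (Hinf_one \<Omega>) = 1"
  using assms by (auto simp: algebra_hom_def)

text \<open>Places the value of the character inside the disc, so that \<open>\<phi>\<close> maps it
  to a point of \<Omega>.\<close>

lemma weakly_continuous_character_disc_coordinate:
  assumes \<phi>: "biholomorphic_map (ball 0 1) \<Omega> \<phi>" and hom: "algebra_hom \<Omega> \<psi>"
    and cont: "continuous_map (weak_topology \<Omega> \<phi>) euclidean \<psi>"
  shows "norm (\<psi> (disc_coordinate \<Omega> \<phi>)) < 1"
proof (rule ccontr)
  define \<theta> where "\<theta> = disc_coordinate \<Omega> \<phi>"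
  have \<theta>: "\<theta> \<in> Hinf \<Omega>" unfolding \<theta>_def by (rule disc_coordinate_in_Hinf[OF \<phi>])
  define w where "w = \<psi> \<theta>"
  assume "\<not> norm (\<psi> (disc_coordinate \<Omega> \<phi>)) < 1"
  then have w: "norm w \<ge> 1" by (simp add: w_def \<theta>_def)
  \<comment> \<open>In the disc coordinate this is (1 + z/w)/2; the coefficient of
    \<open>\<theta>\<close> is chosen to give \<open>\<psi> p = 1\<close>.\<close>
  define p where "p = (\<lambda>z. 1/2 * Hinf_one \<Omega> z + 1 / (2 * w) * \<theta> z)"
  have p: "p \<in> Hinf \<Omega>" unfolding p_def by (intro Hinf_add Hinf_scale \<theta> Hinf_one_in)
  have \<psi>p: "\<psi> p = 1"
  proof -
    have "\<psi> p = 1/2 * \<psi> (Hinf_one \<Omega>) + 1 / (2 * w) * \<psi> \<theta>"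
      unfolding p_def using algebra_homD[OF hom] by (simp only: Hinf_scale \<theta> Hinf_one_in)
    then show ?thesis using w algebra_homD(4)[OF hom \<theta>] by (auto simp: w_def[symmetric])
  qed
  \<comment> \<open>Since 0 ^ 0 = 1, the bare power with n = 0 would not vanish outside \<Omega>;
    the factor \<open>Hinf_one \<Omega>\<close> makes \<open>f 0\<close> the unit.\<close>
  define f where "f = (\<lambda>n z. Hinf_one \<Omega> z * p z ^ n)"
  have fSuc: "f (Suc n) = (\<lambda>z. p z * f n z)" for n by (auto simp: f_def)
  have f: "f n \<in> Hinf \<Omega> \<and> \<psi> (f n) = 1" for n
  proof (induction n)
    case 0
    then show ?case using algebra_homD(4)[OF hom \<theta>] Hinf_one_in by (simp add: f_def)
  next
    case (Suc n)
    then show ?case unfolding fSuc using Hinf_mult[OF p] algebra_homD(3)[OF hom p] \<psi>p by simp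
  qed
  have zero: "(\<lambda>_. 0) \<in> Hinf \<Omega>" by (rule HinfI[of _ _ 0]) auto
  \<comment> \<open>In the disc coordinate \<open>f n\<close> is a polynomial, so its boundary
    values are ordinary values.\<close>
  have bv: "boundary_value (f n \<circ> \<phi>) (cis t) = ((1 + cis t / w) / 2) ^ n" for n t
  proof (rule boundary_value_eq_continuous[where h="\<lambda>z. ((1 + z / w) / 2) ^ n"])
    show "isCont (\<lambda>z. ((1 + z / w) / 2) ^ n) (cis t)" using w by (intro continuous_intros) auto
    fix z :: complex assume z: "z \<in> ball 0 1"
    have "\<phi> z \<in> \<Omega>" "inv_into (ball 0 1) \<phi> (\<phi> z) = z"
      using \<phi> z by (auto simp: biholomorphic_map_def bij_betw_def inv_into_f_f)
    then show "(f n \<circ> \<phi>) z = ((1 + z / w) / 2) ^ n"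
      by (simp add: f_def p_def Hinf_one_def \<theta>_def disc_coordinate_def add_divide_distrib mult.commute)
  qed simp
  have bv0: "boundary_value (\<lambda>_. 0) (cis t) = 0" for t
    by (rule boundary_value_eq_continuous[where h="\<lambda>_. 0"]) auto
  have "limitin (weak_topology \<Omega> \<phi>) f (\<lambda>_. 0) sequentially"
  proof (rule limitin_weak_topology)
    fix F assume "F \<in> L1_circle"
    from peak_power_integral_tendsto_0[OF this w]
    show "(\<lambda>n. predual_functional \<phi> F (f n)) \<longlonglongrightarrow> predual_functional \<phi> F (\<lambda>_. 0)"
      by (simp add: predual_functional_def bv bv0 o_def[of "\<lambda>_. 0"])
  qed (use f zero in auto)
  then have "limitin euclidean (\<psi> \<circ> f) (\<psi> (\<lambda>_. 0)) sequentially"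
    by (rule continuous_map_limit[OF cont])
  then have "(\<lambda>n. 1) \<longlonglongrightarrow> \<psi> (\<lambda>_. 0)" using f by (simp add: o_def)
  moreover have "\<psi> (\<lambda>_. 0) = 0" using algebra_homD(2)[OF hom zero, of 0] by simp
  ultimately show False using LIMSEQ_unique[OF tendsto_const] by fastforce
qed

lemma weakly_continuous_character_is_point_eval:
  assumes \<phi>: "biholomorphic_map (ball 0 1) \<Omega> \<phi>" and hom: "algebra_hom \<Omega> \<psi>"
    and cont: "continuous_map (weak_topology \<Omega> \<phi>) euclidean \<psi>"
  obtains l where "l \<in> \<Omega>" "\<And>f. f \<in> Hinf \<Omega> \<Longrightarrow> \<psi> f = f l"
proof -
  define \<theta> where "\<theta> = disc_coordinate \<Omega> \<phi>"
  have \<theta>: "\<theta> \<in> Hinf \<Omega>" unfolding \<theta>_def by (rule disc_coordinate_in_Hinf[OF \<phi>])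
  define w where "w = \<psi> \<theta>"
  have w: "w \<in> ball 0 1"
    using weakly_continuous_character_disc_coordinate[OF assms] by (simp add: w_def \<theta>_def)
  have inv: "\<And>z. z \<in> \<Omega> \<Longrightarrow> \<phi> (\<theta> z) = z" "\<theta> ` \<Omega> \<subseteq> ball 0 1" "\<theta> holomorphic_on \<Omega>"
    using biholomorphic_map_disc_coordinate[OF \<phi>] \<theta> by (auto simp: \<theta>_def disc_coordinate_def Hinf_def)
  show thesis
  proof
    show "\<phi> w \<in> \<Omega>" using \<phi> w by (auto simp: biholomorphic_map_def bij_betw_def)
    fix f assume f: "f \<in> Hinf \<Omega>"
    obtain B where B: "\<And>z. z \<in> ball 0 1 \<Longrightarrow> norm ((f \<circ> \<phi>) z) \<le> B"
      using Hinf_pullback_disc(2)[OF \<phi> f] unfolding bounded_iff by blast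
    obtain h C where h: "h holomorphic_on ball 0 1" "\<And>z. z \<in> ball 0 1 \<Longrightarrow> norm (h z) \<le> C"
        "\<And>z. (f \<circ> \<phi>) z - (f \<circ> \<phi>) w = (z - w) * h z"
      using bounded_difference_quotient[OF Hinf_pullback_disc(1)[OF \<phi> f] B w] by blast
    define k where "k = (\<lambda>z. if z \<in> \<Omega> then h (\<theta> z) else 0)"
    have k: "k \<in> Hinf \<Omega>" unfolding k_def by (rule Hinf_compose[OF inv(3,2) h(1,2)])
    \<comment> \<open>The factorisation over the disc, pulled back to \<Omega>. Constants are
      multiples of \<open>Hinf_one \<Omega>\<close>, so both sides vanish outside \<Omega>. Applying
      \<open>\<psi>\<close> annihilates the first factor, because
      \<open>\<psi> \<theta> = w\<close>.\<close>
    have "(\<lambda>z. f z + (- f (\<phi> w)) * Hinf_one \<Omega> z) = (\<lambda>z. (\<theta> z + (- w) * Hinf_one \<Omega> z) * k z)"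
    proof
      fix z show "f z + (- f (\<phi> w)) * Hinf_one \<Omega> z = (\<theta> z + (- w) * Hinf_one \<Omega> z) * k z"
        using h(3)[of "\<theta> z"] inv(1)[of z] f by (auto simp: k_def Hinf_one_def Hinf_def)
    qed
    then have "\<psi> (\<lambda>z. f z + (- f (\<phi> w)) * Hinf_one \<Omega> z) = \<psi> (\<lambda>z. (\<theta> z + (- w) * Hinf_one \<Omega> z) * k z)"
      by simp
    then have "\<psi> f + (- f (\<phi> w)) * \<psi> (Hinf_one \<Omega>) = (\<psi> \<theta> + (- w) * \<psi> (Hinf_one \<Omega>)) * \<psi> k"
      using algebra_homD(1-3)[OF hom] by (simp only: Hinf_scale Hinf_add \<theta> k f Hinf_one_in)
    then show "\<psi> f = f (\<phi> w)"
      using algebra_homD(4)[OF hom f] by (simp add: w_def)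
  qed
qed

section \<open>Characters compatible with the involution\<close>

theorem propositionB7:
  fixes \<Omega> :: "complex set" and \<sigma> \<phi> :: "complex \<Rightarrow> complex"
  assumes "open \<Omega>" "connected \<Omega>" "simply_connected \<Omega>" "\<Omega> \<noteq> {}" "\<Omega> \<noteq> UNIV"
    and "antiholomorphic_involution \<Omega> \<sigma>"
    and "biholomorphic_map (ball 0 1) \<Omega> \<phi>"
  shows "{\<psi> \<in> extensional (Hinf \<Omega>). star_hom \<Omega> \<sigma> \<psi> \<and> continuous_map (weak_topology \<Omega> \<phi>) euclidean \<psi>}
       = point_eval \<Omega> ` {z \<in> \<Omega>. \<sigma> z = z}"
proof (intro equalityI subsetI)
  fix \<psi> assume "\<psi> \<in> {\<psi> \<in> extensional (Hinf \<Omega>). star_hom \<Omega> \<sigma> \<psi> \<and> continuous_map (weak_topology \<Omega> \<phi>) euclidean \<psi>}"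
  then have ext: "\<psi> \<in> extensional (Hinf \<Omega>)" and hom: "algebra_hom \<Omega> \<psi>"
    and star: "\<And>f. f \<in> Hinf \<Omega> \<Longrightarrow> \<psi> (sharp \<Omega> \<sigma> f) = cnj (\<psi> f)"
    and cont: "continuous_map (weak_topology \<Omega> \<phi>) euclidean \<psi>"
    by (auto simp: star_hom_def)
  obtain l where l: "l \<in> \<Omega>" "\<And>f. f \<in> Hinf \<Omega> \<Longrightarrow> \<psi> f = f l"
    using weakly_continuous_character_is_point_eval[OF assms(7) hom cont] by blast
  \<comment> \<open>Agreement on \<open>Hinf \<Omega>\<close> suffices, as both functionals are
    \<open>undefined\<close> elsewhere.\<close>
  have "\<psi> = point_eval \<Omega> l"
    using ext l(2) by (auto simp: point_eval_def fun_eq_iff extensional_def restrict_def)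
  moreover have "\<sigma> l = l"
  proof -
    \<comment> \<open>The disc coordinate separates points of \<Omega>, so testing the involution on
      it alone identifies \<open>\<sigma> l\<close> with \<open>l\<close>.\<close>
    note \<theta> = disc_coordinate_in_Hinf[OF assms(7)]
    have \<sigma>l: "\<sigma> l \<in> \<Omega>" using assms(6) l(1) by (auto simp: antiholomorphic_involution_def)
    have "sharp \<Omega> \<sigma> (disc_coordinate \<Omega> \<phi>) l = cnj (disc_coordinate \<Omega> \<phi> l)"
      using star[OF \<theta>] l(2)[OF \<theta>] l(2)[OF sharp_in_Hinf[OF assms(1,6) \<theta>]] by simp
    then have "inv_into (ball 0 1) \<phi> (\<sigma> l) = inv_into (ball 0 1) \<phi> l"
      using l(1) \<sigma>l by (simp add: sharp_def disc_coordinate_def)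
    then show ?thesis
      using biholomorphic_map_disc_coordinate(2)[OF assms(7)] l(1) \<sigma>l by metis
  qed
  ultimately show "\<psi> \<in> point_eval \<Omega> ` {z \<in> \<Omega>. \<sigma> z = z}" using l(1) by blast
next
  fix \<psi> assume "\<psi> \<in> point_eval \<Omega> ` {z \<in> \<Omega>. \<sigma> z = z}"
  then obtain l where l: "\<psi> = point_eval \<Omega> l" "l \<in> \<Omega>" "\<sigma> l = l" by blast
  have "\<psi> \<in> extensional (Hinf \<Omega>)" unfolding l(1) point_eval_def by (rule restrict_extensional)
  then show "\<psi> \<in> {\<psi> \<in> extensional (Hinf \<Omega>). star_hom \<Omega> \<sigma> \<psi> \<and> continuous_map (weak_topology \<Omega> \<phi>) euclidean \<psi>}"
    using point_eval_star_hom[OF assms(1,6) l(2,3)] point_eval_weakly_continuous[OF assms(7) l(2)] l(1)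
    by simp
qed

end
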